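(* Let $(R,\mathfrak m,k)$ be a $3$-dimensional Noetherian local ring and let $M$ be a reflexive $R$-module (not necessarily finitely generated) such that $\operatorname{Tor}_i^R(M,k)=0$ for some integer $i>0$. Then $\operatorname{Tor}_j^R(M,k)=0$ for all $j>i$.
   Context: With $M^*=\operatorname{Hom}_R(M,R)$, a module $M$ is reflexive if the canonical map $M\to M^{**}$ is an isomorphism. *)

theory Defs
  imports
    "HOL-Algebra.Module"
    "HOL-Algebra.Ring_Divisibility"
    "HOL-Library.Extended_Nat"
    "HOL-Library.FSet"
begin

text \<open>
  Modules over a commutative ring are records of type \<open>('a, 'b) module\<close>, as in the theory
  \<open>Module\<close> of HOL-Algebra. The fields \<open>mult\<close> and \<open>one\<close>, which such a record inherits from
  the type of rings, play no role in the locale \<^locale>\<open>module\<close>; the constructions below leave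
  them unspecified.
\<close>

section \<open>Local rings and Krull dimension\<close>

definition local_ring :: "('a, 'm) ring_scheme \<Rightarrow> 'a set \<Rightarrow> bool" where
  "local_ring R \<mm> \<longleftrightarrow>
     cring R \<and> maximalideal \<mm> R \<and> (\<forall>J. maximalideal J R \<longrightarrow> J = \<mm>)"

text \<open>
  The supremum in \<^typ>\<open>enat\<close> of the lengths \<open>n\<close> of chains \<open>P\<^sub>0 \<subset> \<dots> \<subset> P\<^sub>n\<close> of prime ideals.
  For the zero ring the result is \<open>0\<close>, but local rings are nonzero.
\<close>

definition krull_dim :: "('a, 'm) ring_scheme \<Rightarrow> enat" where
  "krull_dim R =
     Sup {enat n |n. \<exists>P :: nat \<Rightarrow> 'a set.
            (\<forall>i\<le>n. primeideal (P i) R) \<and> (\<forall>i<n. P i \<subset> P (Suc i))}"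

section \<open>Basic constructions with modules\<close>

definition self_module :: "('a, 'm) ring_scheme \<Rightarrow> ('a, 'a) module" where
  "self_module R =
     \<lparr>carrier = carrier R, monoid.mult = undefined, one = undefined,
      ring.zero = \<zero>\<^bsub>R\<^esub>, ring.add = (\<oplus>\<^bsub>R\<^esub>), smult = (\<otimes>\<^bsub>R\<^esub>)\<rparr>"

text \<open>Elements of \<open>M/U\<close> are the cosets of \<open>U\<close>, as for \<^const>\<open>FactRing\<close>.\<close>

definition quot_module ::
    "('a, 'b, 'n) module_scheme \<Rightarrow> 'b set \<Rightarrow> ('a, 'b set) module" where
  "quot_module M U =
     \<lparr>carrier = a_rcosets\<^bsub>M\<^esub> U, monoid.mult = undefined, one = undefined,
      ring.zero = U, ring.add = set_add M,
      smult = (\<lambda>r X. \<Union>x\<in>X. U +>\<^bsub>M\<^esub> (r \<odot>\<^bsub>M\<^esub> x))\<rparr>"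

definition residue_field :: "('a, 'm) ring_scheme \<Rightarrow> 'a set \<Rightarrow> ('a, 'a set) module" where
  "residue_field R \<mm> = quot_module (self_module R) \<mm>"

definition span_module ::
    "('a, 'm) ring_scheme \<Rightarrow> ('a, 'b, 'n) module_scheme \<Rightarrow> 'b set \<Rightarrow> 'b set" where
  "span_module R M X = \<Inter>{U. submodule U R M \<and> X \<subseteq> U}"

text \<open>The free module on \<open>S\<close>: finitely supported functions on \<open>S\<close>, extended by zero.\<close>

definition free_module :: "('a, 'm) ring_scheme \<Rightarrow> 's set \<Rightarrow> ('a, 's \<Rightarrow> 'a) module" where
  "free_module R S =
     \<lparr>carrier = {f. (\<forall>s\<in>S. f s \<in> carrier R) \<and> (\<forall>s. s \<notin> S \<longrightarrow> f s = \<zero>\<^bsub>R\<^esub>)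
                    \<and> finite {s. f s \<noteq> \<zero>\<^bsub>R\<^esub>}},
      monoid.mult = undefined, one = undefined,
      ring.zero = (\<lambda>_. \<zero>\<^bsub>R\<^esub>), ring.add = (\<lambda>f g s. f s \<oplus>\<^bsub>R\<^esub> g s),
      smult = (\<lambda>r f s. r \<otimes>\<^bsub>R\<^esub> f s)\<rparr>"

definition basis_vec :: "('a, 'm) ring_scheme \<Rightarrow> 's \<Rightarrow> 's \<Rightarrow> 'a" where
  "basis_vec R s = (\<lambda>t. if t = s then \<one>\<^bsub>R\<^esub> else \<zero>\<^bsub>R\<^esub>)"

text \<open>
  The linear map from a free module to \<open>M\<close> with prescribed values \<open>g\<close> on the basis. The sum is
  restricted to the support since \<^const>\<open>finsum\<close> over an infinite set is zero.
\<close>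

definition linear_ext ::
    "('a, 'm) ring_scheme \<Rightarrow> ('a, 'b, 'n) module_scheme \<Rightarrow> ('s \<Rightarrow> 'b) \<Rightarrow> ('s \<Rightarrow> 'a) \<Rightarrow> 'b" where
  "linear_ext R M g f =
     finsum M (\<lambda>s. f s \<odot>\<^bsub>M\<^esub> g s) {s. f s \<noteq> \<zero>\<^bsub>R\<^esub>}"

section \<open>Reflexive modules\<close>

text \<open>
  \<open>Hom\<^sub>R(M, N)\<close>; homomorphisms are made extensional (\<^const>\<open>undefined\<close> outside the carrier of
  \<open>M\<close>) so that equality of homomorphisms is equality of functions.
\<close>

definition Hom_module ::
    "('a, 'm) ring_scheme \<Rightarrow> ('a, 'b, 'n) module_scheme \<Rightarrow> ('a, 'c, 'p) module_scheme
      \<Rightarrow> ('a, 'b \<Rightarrow> 'c) module" where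
  "Hom_module R M N =
     \<lparr>carrier = {f \<in> carrier M \<rightarrow>\<^sub>E carrier N.
          (\<forall>x\<in>carrier M. \<forall>y\<in>carrier M. f (x \<oplus>\<^bsub>M\<^esub> y) = f x \<oplus>\<^bsub>N\<^esub> f y) \<and>
          (\<forall>r\<in>carrier R. \<forall>x\<in>carrier M. f (r \<odot>\<^bsub>M\<^esub> x) = r \<odot>\<^bsub>N\<^esub> f x)},
      monoid.mult = undefined, one = undefined,
      ring.zero = (\<lambda>x\<in>carrier M. \<zero>\<^bsub>N\<^esub>),
      ring.add = (\<lambda>f g. \<lambda>x\<in>carrier M. f x \<oplus>\<^bsub>N\<^esub> g x),
      smult = (\<lambda>r f. \<lambda>x\<in>carrier M. r \<odot>\<^bsub>N\<^esub> f x)\<rparr>"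

definition dual_module ::
    "('a, 'm) ring_scheme \<Rightarrow> ('a, 'b, 'n) module_scheme \<Rightarrow> ('a, 'b \<Rightarrow> 'a) module" where
  "dual_module R M = Hom_module R M (self_module R)"

definition bidual_map ::
    "('a, 'm) ring_scheme \<Rightarrow> ('a, 'b, 'n) module_scheme \<Rightarrow> 'b \<Rightarrow> ('b \<Rightarrow> 'a) \<Rightarrow> 'a" where
  "bidual_map R M = (\<lambda>x\<in>carrier M. \<lambda>\<phi>\<in>carrier (dual_module R M). \<phi> x)"

definition reflexive_module ::
    "('a, 'm) ring_scheme \<Rightarrow> ('a, 'b, 'n) module_scheme \<Rightarrow> bool" where
  "reflexive_module R M \<longleftrightarrow> module R M \<and>
     bidual_map R M \<in> carrier (Hom_module R M (dual_module R (dual_module R M))) \<and>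
     bij_betw (bidual_map R M) (carrier M) (carrier (dual_module R (dual_module R M)))"

section \<open>Tensor products\<close>

text \<open>
  \<open>M \<otimes>\<^sub>R N\<close> is the free module on \<open>M \<times> N\<close> modulo the submodule generated by the bilinearity
  relations.
\<close>

definition tensor_rels ::
    "('a, 'm) ring_scheme \<Rightarrow> ('a, 'b, 'n) module_scheme \<Rightarrow> ('a, 'c, 'p) module_scheme
      \<Rightarrow> ('b \<times> 'c \<Rightarrow> 'a) set" where
  "tensor_rels R M N =
    (let F = free_module R (carrier M \<times> carrier N); \<delta> = (\<lambda>x y. basis_vec R (x, y)) in
      {\<delta> (x \<oplus>\<^bsub>M\<^esub> x') y \<ominus>\<^bsub>F\<^esub> (\<delta> x y \<oplus>\<^bsub>F\<^esub> \<delta> x' y) |x x' y.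
         x \<in> carrier M \<and> x' \<in> carrier M \<and> y \<in> carrier N} \<union>
      {\<delta> x (y \<oplus>\<^bsub>N\<^esub> y') \<ominus>\<^bsub>F\<^esub> (\<delta> x y \<oplus>\<^bsub>F\<^esub> \<delta> x y') |x y y'.
         x \<in> carrier M \<and> y \<in> carrier N \<and> y' \<in> carrier N} \<union>
      {\<delta> (r \<odot>\<^bsub>M\<^esub> x) y \<ominus>\<^bsub>F\<^esub> (r \<odot>\<^bsub>F\<^esub> \<delta> x y) |r x y.
         r \<in> carrier R \<and> x \<in> carrier M \<and> y \<in> carrier N} \<union>
      {\<delta> x (r \<odot>\<^bsub>N\<^esub> y) \<ominus>\<^bsub>F\<^esub> (r \<odot>\<^bsub>F\<^esub> \<delta> x y) |r x y.
         r \<in> carrier R \<and> x \<in> carrier M \<and> y \<in> carrier N})"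

definition tensor_ker ::
    "('a, 'm) ring_scheme \<Rightarrow> ('a, 'b, 'n) module_scheme \<Rightarrow> ('a, 'c, 'p) module_scheme
      \<Rightarrow> ('b \<times> 'c \<Rightarrow> 'a) set" where
  "tensor_ker R M N =
     span_module R (free_module R (carrier M \<times> carrier N)) (tensor_rels R M N)"

definition tensor_module ::
    "('a, 'm) ring_scheme \<Rightarrow> ('a, 'b, 'n) module_scheme \<Rightarrow> ('a, 'c, 'p) module_scheme
      \<Rightarrow> ('a, ('b \<times> 'c \<Rightarrow> 'a) set) module" where
  "tensor_module R M N =
     quot_module (free_module R (carrier M \<times> carrier N)) (tensor_ker R M N)"

definition pure_tensor ::
    "('a, 'm) ring_scheme \<Rightarrow> ('a, 'b, 'n) module_scheme \<Rightarrow> ('a, 'c, 'p) module_scheme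
      \<Rightarrow> 'b \<Rightarrow> 'c \<Rightarrow> ('b \<times> 'c \<Rightarrow> 'a) set" where
  "pure_tensor R M N x y =
     tensor_ker R M N +>\<^bsub>free_module R (carrier M \<times> carrier N)\<^esub> basis_vec R (x, y)"

text \<open>
  The map \<open>h \<otimes> N\<close> into \<open>M' \<otimes> N\<close> induced by \<open>h\<close> from \<open>M\<close> to \<open>M'\<close>: for \<open>h\<close> linear, the linear
  extension of \<open>(x, y) \<mapsto> h x \<otimes> y\<close> is constant on each coset \<open>X \<in> M \<otimes> N\<close>.
\<close>

definition tensor_map ::
    "('a, 'm) ring_scheme \<Rightarrow> ('a, 'd, 'q) module_scheme \<Rightarrow> ('a, 'c, 'p) module_scheme
      \<Rightarrow> ('b \<Rightarrow> 'd) \<Rightarrow> ('b \<times> 'c \<Rightarrow> 'a) set \<Rightarrow> ('d \<times> 'c \<Rightarrow> 'a) set" where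
  "tensor_map R M' N h X =
     the_elem (linear_ext R (tensor_module R M' N)
                 (\<lambda>(x, y). pure_tensor R M' N (h x) y) ` X)"

section \<open>The canonical free resolution\<close>

text \<open>
  Every module \<open>L\<close> is the image of the free module on its own set of elements, and iterating this
  on the successive kernels resolves \<open>M\<close> by free modules. To have all terms of the resolution in
  one type, the basis elements are taken from the following type: \<open>Elem x\<close> indexes an element of
  \<open>M\<close>, and \<open>Comb A\<close> indexes the linear combination of basis elements (an element of a free module
  and hence of a syzygy) whose nonzero coefficients are recorded in \<open>A\<close>.
\<close>

datatype ('a, 'b) basis_index = Elem 'b | Comb "(('a, 'b) basis_index \<times> 'a) fset"

definition comb_index ::
    "('a, 'm) ring_scheme \<Rightarrow> (('a, 'b) basis_index \<Rightarrow> 'a) \<Rightarrow> ('a, 'b) basis_index" where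
  "comb_index R f = Comb (Abs_fset {(s, f s) |s. f s \<noteq> \<zero>\<^bsub>R\<^esub>})"

text \<open>
  The free module on the elements of \<open>L\<close>, indexed by an injection \<open>c\<close>, the map onto \<open>L\<close> that
  sends the basis vector of \<open>c x\<close> to \<open>x\<close>, and the kernel of that map.
\<close>

definition free_cover ::
    "('a, 'm) ring_scheme \<Rightarrow> ('a, 'l, 'n) module_scheme \<Rightarrow> ('l \<Rightarrow> 's) \<Rightarrow> ('a, 's \<Rightarrow> 'a) module" where
  "free_cover R L c = free_module R (c ` carrier L)"

definition cover_map ::
    "('a, 'm) ring_scheme \<Rightarrow> ('a, 'l, 'n) module_scheme \<Rightarrow> ('l \<Rightarrow> 's) \<Rightarrow> ('s \<Rightarrow> 'a) \<Rightarrow> 'l" where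
  "cover_map R L c = linear_ext R L (the_inv_into (carrier L) c)"

definition cover_kernel ::
    "('a, 'm) ring_scheme \<Rightarrow> ('a, 'l, 'n) module_scheme \<Rightarrow> ('l \<Rightarrow> 's) \<Rightarrow> ('a, 's \<Rightarrow> 'a) module" where
  "cover_kernel R L c =
     (free_cover R L c)\<lparr>carrier := a_kernel (free_cover R L c) L (cover_map R L c)\<rparr>"

text \<open>\<open>syzygy R M n\<close> is the \<open>(n+1)\<close>-st syzygy, a submodule of the \<open>n\<close>-th term of the resolution.\<close>

primrec syzygy ::
    "('a, 'm) ring_scheme \<Rightarrow> ('a, 'b, 'n) module_scheme \<Rightarrow> nat
      \<Rightarrow> ('a, ('a, 'b) basis_index \<Rightarrow> 'a) module" where
  "syzygy R M 0 = cover_kernel R M Elem"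
| "syzygy R M (Suc n) = cover_kernel R (syzygy R M n) (comb_index R)"

text \<open>The resolution \<open>\<dots> \<rightarrow> F\<^sub>2 \<rightarrow> F\<^sub>1 \<rightarrow> F\<^sub>0\<close>, with \<open>res_diff R M n\<close> mapping \<open>F\<^sub>n\<^sub>+\<^sub>1\<close> to \<open>F\<^sub>n\<close>.\<close>

primrec res_term ::
    "('a, 'm) ring_scheme \<Rightarrow> ('a, 'b, 'n) module_scheme \<Rightarrow> nat
      \<Rightarrow> ('a, ('a, 'b) basis_index \<Rightarrow> 'a) module" where
  "res_term R M 0 = free_cover R M Elem"
| "res_term R M (Suc n) = free_cover R (syzygy R M n) (comb_index R)"

definition res_diff ::
    "('a, 'm) ring_scheme \<Rightarrow> ('a, 'b, 'n) module_scheme \<Rightarrow> nat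
      \<Rightarrow> (('a, 'b) basis_index \<Rightarrow> 'a) \<Rightarrow> (('a, 'b) basis_index \<Rightarrow> 'a)" where
  "res_diff R M n = cover_map R (syzygy R M n) (comb_index R)"

section \<open>Tor\<close>

text \<open>
  \<open>Tor\<^sub>n\<^sup>R(M, N)\<close> is the \<open>n\<close>-th homology of \<open>F \<otimes>\<^sub>R N\<close>, where \<open>F\<close> is the canonical free
  resolution of \<open>M\<close>; any other projective resolution of \<open>M\<close> gives an isomorphic module.
\<close>

definition tor_term ::
    "('a, 'm) ring_scheme \<Rightarrow> ('a, 'b, 'n) module_scheme \<Rightarrow> ('a, 'c, 'p) module_scheme \<Rightarrow> nat
      \<Rightarrow> ('a, ((('a, 'b) basis_index \<Rightarrow> 'a) \<times> 'c \<Rightarrow> 'a) set) module" where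
  "tor_term R M N n = tensor_module R (res_term R M n) N"

definition tor_diff ::
    "('a, 'm) ring_scheme \<Rightarrow> ('a, 'b, 'n) module_scheme \<Rightarrow> ('a, 'c, 'p) module_scheme \<Rightarrow> nat
      \<Rightarrow> ((('a, 'b) basis_index \<Rightarrow> 'a) \<times> 'c \<Rightarrow> 'a) set
      \<Rightarrow> ((('a, 'b) basis_index \<Rightarrow> 'a) \<times> 'c \<Rightarrow> 'a) set" where
  "tor_diff R M N n = tensor_map R (res_term R M n) N (res_diff R M n)"

definition tor_cycles ::
    "('a, 'm) ring_scheme \<Rightarrow> ('a, 'b, 'n) module_scheme \<Rightarrow> ('a, 'c, 'p) module_scheme \<Rightarrow> nat
      \<Rightarrow> ((('a, 'b) basis_index \<Rightarrow> 'a) \<times> 'c \<Rightarrow> 'a) set set" where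
  "tor_cycles R M N n =
     (case n of
        0 \<Rightarrow> carrier (tor_term R M N 0)
      | Suc k \<Rightarrow> a_kernel (tor_term R M N (Suc k)) (tor_term R M N k) (tor_diff R M N k))"

definition tor_boundaries ::
    "('a, 'm) ring_scheme \<Rightarrow> ('a, 'b, 'n) module_scheme \<Rightarrow> ('a, 'c, 'p) module_scheme \<Rightarrow> nat
      \<Rightarrow> ((('a, 'b) basis_index \<Rightarrow> 'a) \<times> 'c \<Rightarrow> 'a) set set" where
  "tor_boundaries R M N n = tor_diff R M N n ` carrier (tor_term R M N (Suc n))"

definition Tor ::
    "('a, 'm) ring_scheme \<Rightarrow> nat \<Rightarrow> ('a, 'b, 'n) module_scheme \<Rightarrow> ('a, 'c, 'p) module_scheme
      \<Rightarrow> ('a, ((('a, 'b) basis_index \<Rightarrow> 'a) \<times> 'c \<Rightarrow> 'a) set set) module" where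
  "Tor R n M N =
     quot_module ((tor_term R M N n)\<lparr>carrier := tor_cycles R M N n\<rparr>) (tor_boundaries R M N n)"

definition is_zero_module :: "('a, 'b, 'n) module_scheme \<Rightarrow> bool" where
  "is_zero_module M \<longleftrightarrow> carrier M = {\<zero>\<^bsub>M\<^esub>}"

end

theory Submission
  imports Defs
begin

text \<open>
  Dualizing a free presentation of \<open>M\<^sup>*\<close> embeds the reflexive module \<open>M = M\<^sup>*\<^sup>*\<close> into an exact sequence
  \<open>0 \<rightarrow> M \<rightarrow> P\<^sub>0 \<rightarrow> P\<^sub>1 \<rightarrow> X \<rightarrow> 0\<close> with \<open>P\<^sub>0\<close> and \<open>P\<^sub>1\<close> products of copies of \<open>R\<close>, which are flat. Hence
  \<open>Tor\<^sub>i(M, k) = Tor\<^sub>i\<^sub>+\<^sub>2(X, k)\<close>, and it suffices to treat \<open>Tor\<^sub>n(X, k) = 0\<close> with \<open>n \<ge> 3 = dim R\<close>.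
  If \<open>Tor\<^sub>n(X, k) = 0\<close>, then \<open>Tor\<^sub>n(X, L) = 0\<close> for all \<open>L\<close> of finite length, so
  \<open>Tor\<^sub>n\<^sub>+\<^sub>1(X, R/J) \<rightarrow> Tor\<^sub>n\<^sub>+\<^sub>1(X, k)\<close> is surjective for every \<open>\<mm>\<close>-primary ideal \<open>J\<close>. For \<open>n + 1 > dim R\<close>
  and \<open>J\<close> generated by suitable powers of a system of parameters this map is also zero. Since a
  linear equation over a free module or a product can be solved coordinatewise, both facts can be
  checked by hand on chains.
\<close>

text \<open>Vanishing is forced instead by a map that is both surjective and zero. Surjectivity
  belongs to \<open>0 \<rightarrow> \<mm>/J \<rightarrow> R/J \<rightarrow> k \<rightarrow>
  0\<close>: since \<open>\<mm>/J\<close> has finite length, the term after \<open>Tor(X, k)\<close>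
  in the long exact sequence vanishes. If the parameters formed a regular sequence, the Koszul
  complex on their powers would be a resolution of length \<open>dim R\<close> and Tor itself would
  vanish above that degree. As \<open>R\<close> need not be Cohen-Macaulay, only maps between
  quotients by different powers vanish: each parameter \<open>y\<close> has a constant
  \<open>c\<close> beyond which the ideals \<open>J : y^k\<close> stop growing, and exponents have
  to be raised by that \<open>c\<close>. Products of copies of \<open>R\<close> are never tensored.
  In place of their flatness stands a statement on divisibility: an element of \<open>M\<close> is a
  multiple of \<open>y^t\<close> as soon as every functional on \<open>M\<close> takes it to a
  multiple of \<open>y^(c + t)\<close>.\<close>

no_notation Sum_Type.Plus (infixr "<+>" 65)

section \<open>Noetherian commutative rings\<close>

lemma (in cring) mem_add_cgenideal:
  assumes "a \<in> carrier R"
  shows "z \<in> I <+> PIdl a \<longleftrightarrow> (\<exists>u\<in>I. \<exists>r\<in>carrier R. z = u \<oplus> a \<otimes> r)"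
proof -
  have "z \<in> I <+> PIdl a \<longleftrightarrow> (\<exists>u\<in>I. \<exists>r\<in>carrier R. z = u \<oplus> r \<otimes> a)"
    unfolding set_add_def' cgenideal_def by auto
  then show ?thesis using assms by (metis m_comm)
qed

lemma (in cring) add_cgenideal:
  assumes "ideal I R" and "a \<in> carrier R"
  shows "ideal (I <+> PIdl a) R" and "I \<subseteq> I <+> PIdl a" and "a \<in> I <+> PIdl a"
proof -
  show "ideal (I <+> PIdl a) R"
    using assms add_ideals cgenideal_ideal by blast
  show "I \<subseteq> I <+> PIdl a"
  proof
    fix z assume "z \<in> I"
    then have "z = z \<oplus> a \<otimes> \<zero>"
      using assms ideal.Icarr by fastforce
    then show "z \<in> I <+> PIdl a"
      using \<open>z \<in> I\<close> mem_add_cgenideal[OF assms(2)] by blast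
  qed
  have "\<zero> \<in> I" by (rule additive_subgroup.zero_closed[OF ideal.axioms(1)[OF assms(1)]])
  moreover have "a = \<zero> \<oplus> a \<otimes> \<one>" using assms by simp
  ultimately show "a \<in> I <+> PIdl a"
    using mem_add_cgenideal[OF assms(2)] by blast
qed

lemma (in cring) add_cgenideal_minimal:
  assumes "ideal J R" "I \<subseteq> J" "a \<in> J"
  shows "I <+> PIdl a \<subseteq> J"
proof
  fix z assume "z \<in> I <+> PIdl a"
  moreover have "a \<in> carrier R" using ideal.Icarr[OF assms(1,3)] .
  ultimately obtain u r where "u \<in> I" "r \<in> carrier R" "z = u \<oplus> a \<otimes> r"
    using mem_add_cgenideal by blast
  then show "z \<in> J"
    using assms by (auto intro!: additive_subgroup.a_closed[OF ideal.axioms(1)] ideal.I_r_closed)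
qed

lemma (in cring) ideal_pow_mono:
  assumes "ideal I R" "x \<in> carrier R" "x [^] n \<in> I" "n \<le> (m::nat)"
  shows "x [^] m \<in> I"
proof -
  have "x [^] m = x [^] n \<otimes> x [^] (m - n)"
    using assms by (simp add: nat_pow_mult)
  then show ?thesis
    using assms by (simp add: ideal.I_r_closed)
qed

lemma (in cring) ideal_colon:
  assumes "ideal I R" "a \<in> carrier R"
  shows "ideal {r \<in> carrier R. a \<otimes> r \<in> I} R"
  using ideal.helper_max_prime[OF assms(1) is_cring assms(2)] .

locale noetherian_cring = noetherian_ring R + cring R for R (structure)
begin

text \<open>The ascending chain condition turned into a maximum condition: by
  \<open>ideal_chain_is_trivial\<close> a nonempty chain of ideals contains its own union, which is
  the upper bound that Zorn's lemma asks for.\<close>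

lemma exists_maximal_in_ideals:
  assumes "A \<noteq> {}" and "\<And>I. I \<in> A \<Longrightarrow> ideal I R"
  shows "\<exists>I\<in>A. \<forall>J\<in>A. I \<subseteq> J \<longrightarrow> J = I"
proof (rule subset_Zorn_nonempty[OF assms(1)])
  fix C assume C: "C \<noteq> {}" "subset.chain A C"
  then have "C \<subseteq> A" by (simp add: pred_on.chain_def)
  moreover from C this have "subset.chain {I. ideal I R} C"
    using assms(2) unfolding pred_on.chain_def by auto
  then have "\<Union>C \<in> C"
    using ideal_chain_is_trivial C(1) by simp
  ultimately show "\<Union>C \<in> A" by (rule subsetD)
qed

text \<open>A maximal counterexample would satisfy the premise of \<open>step\<close>. The induction
  runs from larger ideals to smaller ones.\<close>

lemma noetherian_induct [consumes 1]:
  assumes "ideal I R"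
    and step: "\<And>I. ideal I R \<Longrightarrow> (\<And>J. ideal J R \<Longrightarrow> I \<subset> J \<Longrightarrow> P J) \<Longrightarrow> P I"
  shows "P I"
proof (rule ccontr)
  assume "\<not> P I"
  then have "{I. ideal I R \<and> \<not> P I} \<noteq> {}" using assms(1) by auto
  from exists_maximal_in_ideals[OF this]
  obtain I' where I': "ideal I' R" "\<not> P I'"
    and max: "\<And>J. ideal J R \<Longrightarrow> \<not> P J \<Longrightarrow> I' \<subseteq> J \<Longrightarrow> J = I'"
    by auto
  have "P I'"
  proof (rule step[OF I'(1)])
    fix J assume "ideal J R" "I' \<subset> J"
    then show "P J" using max[of J] by blast
  qed
  then show False using I'(2) by blast
qed

text \<open>The ideals \<open>K n\<close>, that is \<open>J : y^n\<close>, increase with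
  \<open>n\<close>, so a maximal one bounds them all. The resulting \<open>c\<close> measures how
  far \<open>y\<close> is from being regular modulo \<open>J\<close>.\<close>

lemma colon_power_stabilizes:
  assumes J: "ideal J R" and y: "y \<in> carrier R"
  obtains c :: nat where
    "\<And>(n::nat) r. r \<in> carrier R \<Longrightarrow> y [^] n \<otimes> r \<in> J \<Longrightarrow> y [^] c \<otimes> r \<in> J"
proof -
  define K where "K n = {r \<in> carrier R. y [^] n \<otimes> r \<in> J}" for n :: nat
  have "ideal (K n) R" for n
    unfolding K_def using ideal_colon[OF J] y by simp
  then obtain c where c: "\<And>n. K c \<subseteq> K n \<Longrightarrow> K n = K c"
    using exists_maximal_in_ideals[of "range K"] by auto
  have shift: "y [^] (n + k) \<otimes> r \<in> J" if "r \<in> carrier R" "y [^] n \<otimes> r \<in> J" for r and n k :: nat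
  proof -
    have "y [^] (n + k) \<otimes> r = y [^] k \<otimes> (y [^] n \<otimes> r)"
      using that y by (simp add: nat_pow_mult[symmetric] m_ac)
    then show ?thesis using that J y by (simp add: ideal.I_l_closed)
  qed
  show thesis
  proof (rule that)
    fix n :: nat and r assume r: "r \<in> carrier R" "y [^] n \<otimes> r \<in> J"
    \<comment> \<open>Passing to \<open>c + n\<close> spares a comparison of \<open>n\<close> with
      \<open>c\<close>: \<open>shift\<close> puts both \<open>K c\<close> and \<open>r\<close> into
      \<open>K (c + n)\<close>.\<close>
    have "K c \<subseteq> K (c + n)" unfolding K_def using shift by auto
    then have "K (c + n) = K c" by (rule c)
    moreover have "r \<in> K (c + n)" unfolding K_def using shift[OF r, of c] r by (simp add: add.commute)
    ultimately show "y [^] c \<otimes> r \<in> J" unfolding K_def by blast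
  qed
qed

text \<open>An ideal maximal among those that contain \<open>J\<close> and miss all powers of
  \<open>y\<close> is prime. It corresponds to a maximal ideal of the localization of
  \<open>R/J\<close> at \<open>y\<close>, which is thereby not constructed.\<close>

lemma exists_prime_avoiding_powers:
  assumes J: "ideal J R" and y: "y \<in> carrier R" and "\<And>n::nat. y [^] n \<notin> J"
  obtains P where "primeideal P R" "J \<subseteq> P" "y \<notin> P"
proof -
  let ?A = "{I. ideal I R \<and> J \<subseteq> I \<and> (\<forall>n::nat. y [^] n \<notin> I)}"
  have "?A \<noteq> {}" using assms by auto
  from exists_maximal_in_ideals[OF this]
  obtain P where P: "ideal P R" "J \<subseteq> P" "\<And>n::nat. y [^] n \<notin> P"
    and max: "\<And>I. I \<in> ?A \<Longrightarrow> P \<subseteq> I \<Longrightarrow> I = P"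
    by auto
  have hit: "\<exists>n::nat. y [^] n \<in> P <+> PIdl a" if "a \<in> carrier R" "a \<notin> P" for a
  proof (rule ccontr)
    assume "\<nexists>n::nat. y [^] n \<in> P <+> PIdl a"
    then have "P <+> PIdl a \<in> ?A"
      using add_cgenideal[OF P(1) that(1)] P(2) by blast
    then show False
      using max add_cgenideal[OF P(1) that(1)] that(2) by blast
  qed
  have "primeideal P R"
  proof (rule primeidealI[OF P(1) is_cring])
    show "carrier R \<noteq> P" using P(3)[of 0] by auto
    fix a b assume ab: "a \<in> carrier R" "b \<in> carrier R" "a \<otimes> b \<in> P"
    show "a \<in> P \<or> b \<in> P"
    proof (rule ccontr)
      assume "\<not> (a \<in> P \<or> b \<in> P)"
      then obtain m n :: nat where "y [^] m \<in> P <+> PIdl a" "y [^] n \<in> P <+> PIdl b"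
        using hit ab(1,2) by blast
      then obtain u r v s where uv: "u \<in> P" "r \<in> carrier R" "y [^] m = u \<oplus> a \<otimes> r"
        "v \<in> P" "s \<in> carrier R" "y [^] n = v \<oplus> b \<otimes> s"
        unfolding mem_add_cgenideal[OF ab(1)] mem_add_cgenideal[OF ab(2)] by auto
      have c: "u \<in> carrier R" "v \<in> carrier R"
        using uv ideal.Icarr[OF P(1)] by auto
      have "y [^] (m + n) = (u \<oplus> a \<otimes> r) \<otimes> (v \<oplus> b \<otimes> s)"
        using uv y by (simp add: nat_pow_mult[symmetric])
      also have "\<dots> = u \<otimes> (v \<oplus> b \<otimes> s) \<oplus> (v \<otimes> (a \<otimes> r) \<oplus> (a \<otimes> b) \<otimes> (r \<otimes> s))"
        using c ab uv by (simp add: l_distr r_distr m_ac a_ac)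
      also have "\<dots> \<in> P"
        using c ab uv
        by (simp add: additive_subgroup.a_closed[OF ideal.axioms(1)[OF P(1)]] ideal.I_r_closed[OF P(1)])
      finally show False using P(3) by blast
    qed
  qed
  then show thesis using that[of P] P(2) P(3)[of 1] y by simp
qed

text \<open>If \<open>a \<otimes> b \<in> I\<close> with neither factor in \<open>I\<close>, every
  prime over \<open>I\<close> lies over \<open>I <+> PIdl a\<close> or \<open>I <+> PIdl b\<close>,
  so two finite families can be united. The family contains all minimal primes of \<open>I\<close>,
  possibly with others; finiteness is what prime avoidance needs.\<close>

lemma finite_primes_below:
  assumes "ideal I R"
  shows "\<exists>\<Q>. finite \<Q> \<and> (\<forall>Q\<in>\<Q>. primeideal Q R \<and> I \<subseteq> Q) \<and>
           (\<forall>P. primeideal P R \<longrightarrow> I \<subseteq> P \<longrightarrow> (\<exists>Q\<in>\<Q>. Q \<subseteq> P))"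
  using assms
proof (induction I rule: noetherian_induct)
  case (1 I)
  consider "primeideal I R" | "carrier R = I"
    | a b where "a \<in> carrier R" "b \<in> carrier R" "a \<otimes> b \<in> I" "a \<notin> I" "b \<notin> I"
    using ideal.primeidealCD[OF 1(1) is_cring] by blast
  then show ?case
  proof cases
    case 1
    then show ?thesis by (intro exI[of _ "{I}"]) auto
  next
    case 2
    then have "\<not> I \<subseteq> P" if "primeideal P R" for P
      using primeideal.I_notcarr[OF that] ideal.Icarr[OF primeideal.axioms(1)[OF that]] by blast
    then show ?thesis by (intro exI[of _ "{}"]) auto
  next
    case 3
    have *: "I \<subset> I <+> PIdl x" if "x \<in> carrier R" "x \<notin> I" for x
      using add_cgenideal[OF \<open>ideal I R\<close> that(1)] that(2) by blast
    obtain \<A> where A: "finite \<A>" "\<forall>Q\<in>\<A>. primeideal Q R \<and> I <+> PIdl a \<subseteq> Q"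
      "\<forall>P. primeideal P R \<longrightarrow> I <+> PIdl a \<subseteq> P \<longrightarrow> (\<exists>Q\<in>\<A>. Q \<subseteq> P)"
      using 1(2)[OF add_cgenideal(1)[OF \<open>ideal I R\<close> 3(1)] *[OF 3(1,4)]] by blast
    obtain \<B> where B: "finite \<B>" "\<forall>Q\<in>\<B>. primeideal Q R \<and> I <+> PIdl b \<subseteq> Q"
      "\<forall>P. primeideal P R \<longrightarrow> I <+> PIdl b \<subseteq> P \<longrightarrow> (\<exists>Q\<in>\<B>. Q \<subseteq> P)"
      using 1(2)[OF add_cgenideal(1)[OF \<open>ideal I R\<close> 3(2)] *[OF 3(2,5)]] by blast
    have "\<exists>Q\<in>\<A> \<union> \<B>. Q \<subseteq> P" if P: "primeideal P R" "I \<subseteq> P" for P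
    proof -
      have "a \<in> P \<or> b \<in> P"
        using primeideal.I_prime[OF P(1)] 3 P(2) by blast
      then have "I <+> PIdl a \<subseteq> P \<or> I <+> PIdl b \<subseteq> P"
        using add_cgenideal_minimal[OF primeideal.axioms(1)[OF P(1)] P(2)] by blast
      then show ?thesis using A(3) B(3) P(1) by blast
    qed
    moreover have "\<forall>Q\<in>\<A> \<union> \<B>. primeideal Q R \<and> I \<subseteq> Q"
      using A(2) B(2) * 3 by blast
    ultimately show ?thesis
      using A(1) B(1) by (intro exI[of _ "\<A> \<union> \<B>"]) simp
  qed
qed

end

text \<open>The element is a product of one factor from each \<open>Q\<close> outside
  \<open>P\<close>; it stays outside \<open>P\<close> because \<open>P\<close> is prime.\<close>

lemma (in cring) exists_in_ideals_not_in_prime: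
  assumes P: "primeideal P R" and "finite \<Q>"
    and "\<And>Q. Q \<in> \<Q> \<Longrightarrow> ideal Q R" and "\<And>Q. Q \<in> \<Q> \<Longrightarrow> \<not> Q \<subseteq> P"
  shows "\<exists>y\<in>carrier R - P. \<forall>Q\<in>\<Q>. y \<in> Q"
  using assms(2-)
proof (induction \<Q>)
  case empty
  have "\<one> \<notin> P"
    using ideal.one_imp_carrier[OF primeideal.axioms(1)[OF P]] primeideal.I_notcarr[OF P] by blast
  then show ?case by auto
next
  case (insert Q \<Q>)
  then obtain y where y: "y \<in> carrier R" "y \<notin> P" "\<forall>Q\<in>\<Q>. y \<in> Q" by auto
  obtain z where z: "z \<in> Q" "z \<notin> P" using insert.prems(2)[of Q] by blast
  have zc: "z \<in> carrier R" using ideal.Icarr[OF insert.prems(1)[of Q]] z(1) by simp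
  have "y \<otimes> z \<notin> P" using primeideal.I_prime[OF P y(1) zc] y z by blast
  moreover have "y \<otimes> z \<in> Q'" if "Q' \<in> insert Q \<Q>" for Q'
  proof (cases "Q' = Q")
    case True
    then show ?thesis using insert.prems(1)[of Q] z y by (simp add: ideal.I_l_closed)
  next
    case False
    then have "y \<in> Q'" "ideal Q' R" using that y insert.prems(1) by auto
    then show ?thesis using zc by (simp add: ideal.I_r_closed)
  qed
  ultimately show ?case using y zc by auto
qed

text \<open>Remove a minimal member \<open>P\<close> and take \<open>x\<close> in \<open>A\<close>
  outside all the others. If \<open>x\<close> lies in \<open>P\<close>, add a \<open>y\<close> that
  lies in \<open>A\<close> and in all the others but not in \<open>P\<close>: the sum leaves
  \<open>P\<close> because of \<open>y\<close> and leaves the others because of \<open>x\<close>.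
  Minimality of \<open>P\<close> is what provides such a \<open>y\<close>.\<close>

lemma (in cring) prime_avoidance:
  assumes "finite \<Q>" and A: "ideal A R"
    and "\<And>Q. Q \<in> \<Q> \<Longrightarrow> primeideal Q R" and "\<And>Q. Q \<in> \<Q> \<Longrightarrow> \<not> A \<subseteq> Q"
  shows "\<exists>x\<in>A. \<forall>Q\<in>\<Q>. x \<notin> Q"
  using assms(1,3,4)
proof (induction \<Q> rule: finite_psubset_induct)
  case (psubset \<Q>)
  show ?case
  proof (cases "\<Q> = {}")
    case True
    then show ?thesis
      using additive_subgroup.zero_closed[OF ideal.axioms(1)[OF A]] by blast
  next
    case False
    then obtain P where P: "P \<in> \<Q>" and min: "\<And>Q. Q \<in> \<Q> \<Longrightarrow> Q \<subseteq> P \<Longrightarrow> Q = P"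
      using finite_has_minimal[OF psubset.hyps(1)] by metis
    have prime: "primeideal P R" using P psubset.prems by blast
    obtain x where x: "x \<in> A" "\<forall>Q\<in>\<Q> - {P}. x \<notin> Q"
      using psubset.IH[of "\<Q> - {P}"] P psubset.prems by auto
    show ?thesis
    proof (cases "x \<in> P")
      case False
      then show ?thesis using x by blast
    next
      case True
      \<comment> \<open>\<open>A\<close> is put among the ideals so that \<open>y\<close>, and with
        it \<open>x \<oplus> y\<close>, stays in \<open>A\<close>.\<close>
      have "ideal Q R" if "Q \<in> insert A (\<Q> - {P})" for Q
        using that A psubset.prems primeideal.axioms(1) by blast
      moreover have "\<not> Q \<subseteq> P" if "Q \<in> insert A (\<Q> - {P})" for Q
        using that P min psubset.prems(2) by blast
      moreover have "finite (insert A (\<Q> - {P}))" using psubset.hyps(1) by simp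
      ultimately have "\<exists>y\<in>carrier R - P. \<forall>Q\<in>insert A (\<Q> - {P}). y \<in> Q"
        by (intro exists_in_ideals_not_in_prime[OF prime]) auto
      then obtain y where y: "y \<in> carrier R" "y \<notin> P" "\<And>Q. Q \<in> insert A (\<Q> - {P}) \<Longrightarrow> y \<in> Q"
        by auto
      have xc: "x \<in> carrier R" using ideal.Icarr[OF A x(1)] .
      have cancel: "u \<in> Q" if "ideal Q R" "u \<oplus> v \<in> Q" "v \<in> Q" "u \<in> carrier R" for Q u v
      proof -
        have "v \<in> carrier R" using ideal.Icarr[OF that(1,3)] .
        then have "u = (u \<oplus> v) \<ominus> v" using that(4) by (simp add: minus_eq a_assoc r_neg)
        moreover have "(u \<oplus> v) \<ominus> v \<in> Q"
          using additive_subgroup.a_closed[OF ideal.axioms(1)[OF that(1)] that(2)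
              additive_subgroup.a_inv_closed[OF ideal.axioms(1)[OF that(1)] that(3)]]
          unfolding minus_eq .
        ultimately show ?thesis by simp
      qed
      have "x \<oplus> y \<in> A"
        using x y A by (simp add: additive_subgroup.a_closed[OF ideal.axioms(1)])
      moreover have "x \<oplus> y \<notin> Q" if Q: "Q \<in> \<Q>" for Q
      proof (cases "Q = P")
        case True
        then show ?thesis
          using cancel[OF primeideal.axioms(1)[OF prime], of y x] \<open>x \<in> P\<close> y xc a_comm by metis
      next
        case False
        then show ?thesis
          using cancel[of Q x y] y(3)[of Q] x xc Q psubset.prems(1) primeideal.axioms(1) by blast
      qed
      ultimately show ?thesis by blast
    qed
  qed
qed

section \<open>Parameters of a local ring\<close>

locale noetherian_local_cring = noetherian_cring +
  fixes \<mm>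
  assumes local: "local_ring R \<mm>"
begin

lemma ideal_max: "ideal \<mm> R"
  using local maximalideal.axioms(1) unfolding local_ring_def by blast

lemma max_carrier: "\<mm> \<subseteq> carrier R"
  using ideal.Icarr[OF ideal_max] by blast

lemma prime_max: "primeideal \<mm> R"
  using local maximalideal_prime unfolding local_ring_def by blast

text \<open>The maximum condition yields a maximal ideal over \<open>I\<close>, and locality
  identifies it with \<open>\<mm>\<close>. Besides primes, this is applied to the colon ideals
  \<open>J : a\<close> with \<open>a \<notin> J\<close>.\<close>

lemma proper_ideal_le_max:
  assumes "ideal I R" "I \<noteq> carrier R"
  shows "I \<subseteq> \<mm>"
proof -
  let ?A = "{J. ideal J R \<and> I \<subseteq> J \<and> J \<noteq> carrier R}"
  have "?A \<noteq> {}" using assms by auto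
  from exists_maximal_in_ideals[OF this]
  obtain J where J: "J \<in> ?A" and max: "\<And>K. K \<in> ?A \<Longrightarrow> J \<subseteq> K \<Longrightarrow> K = J"
    by auto
  have "maximalideal J R"
  proof (rule maximalidealI)
    show "ideal J R" "carrier R \<noteq> J" using J by auto
    fix K assume "ideal K R" "J \<subseteq> K" "K \<subseteq> carrier R"
    then show "K = J \<or> K = carrier R" using max[of K] J by blast
  qed
  then show ?thesis using J local unfolding local_ring_def by blast
qed

lemma prime_le_max: "primeideal P R \<Longrightarrow> P \<subseteq> \<mm>"
  using proper_ideal_le_max primeideal.axioms(1) primeideal.I_notcarr by metis

text \<open>The second assumption says \<open>dim R/I \<le> r\<close>. An \<open>x\<close> in
  \<open>\<mm>\<close> that avoids the finitely many primes from \<open>finite_primes_below\<close>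
  other than \<open>\<mm>\<close> lowers this dimension: a chain over \<open>I <+> PIdl x\<close>
  can be prolonged downwards by one of these primes.\<close>

lemma exists_parameters:
  assumes "ideal I R"
    and "\<nexists>P. (\<forall>i\<le>Suc r. primeideal (P i) R \<and> I \<subseteq> P i) \<and> (\<forall>i<Suc r. P i \<subset> P (Suc i))"
  shows "\<exists>xs. length xs = r \<and> set xs \<subseteq> \<mm> \<and>
           (\<forall>P. primeideal P R \<longrightarrow> I \<subseteq> P \<longrightarrow> set xs \<subseteq> P \<longrightarrow> P = \<mm>)"
  using assms
proof (induction r arbitrary: I)
  case 0
  have "P = \<mm>" if P: "primeideal P R" "I \<subseteq> P" for P
  proof (rule ccontr)
    assume "P \<noteq> \<mm>"
    then have "P \<subset> \<mm>" using prime_le_max P by blast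
    \<comment> \<open>A prime other than \<open>\<mm>\<close> would give the forbidden chain
      \<open>P \<subset> \<mm>\<close>, continued constantly since chains are functions on all of
      \<open>nat\<close>.\<close>
    moreover have "primeideal (if i = 0 then P else \<mm>) R" "I \<subseteq> (if i = 0 then P else \<mm>)" for i :: nat
      using P prime_max \<open>P \<subset> \<mm>\<close> by auto
    ultimately show False
      using 0(2) by (auto simp: not_ex elim!: allE[of _ "\<lambda>i. if i = 0 then P else \<mm>"])
  qed
  then show ?case by simp
next
  case (Suc r)
  obtain \<Q> where Q: "finite \<Q>" "\<And>Q. Q \<in> \<Q> \<Longrightarrow> primeideal Q R" "\<And>Q. Q \<in> \<Q> \<Longrightarrow> I \<subseteq> Q"
    and cover: "\<And>P. primeideal P R \<Longrightarrow> I \<subseteq> P \<Longrightarrow> \<exists>Q\<in>\<Q>. Q \<subseteq> P"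
    using finite_primes_below[OF Suc.prems(1)] by blast
  \<comment> \<open>\<open>\<mm>\<close> may occur in \<open>\<Q>\<close>, but no element of
    \<open>\<mm>\<close> avoids it. The exception is harmless: \<open>P 0 = \<mm>\<close> would
    leave no room for \<open>P 1\<close>.\<close>
  have "\<not> \<mm> \<subseteq> Q" if "Q \<in> \<Q> - {\<mm>}" for Q
    using that Q(2)[of Q] prime_le_max by blast
  then obtain x where x: "x \<in> \<mm>" "\<And>Q. Q \<in> \<Q> - {\<mm>} \<Longrightarrow> x \<notin> Q"
    using prime_avoidance[of "\<Q> - {\<mm>}" \<mm>] Q ideal_max by blast
  have xc: "x \<in> carrier R" using x max_carrier by blast
  note J = add_cgenideal[OF Suc.prems(1) xc]
  have "\<nexists>P. (\<forall>i\<le>Suc r. primeideal (P i) R \<and> I <+> PIdl x \<subseteq> P i) \<and> (\<forall>i<Suc r. P i \<subset> P (Suc i))"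
  proof
    assume "\<exists>P. (\<forall>i\<le>Suc r. primeideal (P i) R \<and> I <+> PIdl x \<subseteq> P i) \<and> (\<forall>i<Suc r. P i \<subset> P (Suc i))"
    then obtain P where P: "\<And>i. i \<le> Suc r \<Longrightarrow> primeideal (P i) R"
      "\<And>i. i \<le> Suc r \<Longrightarrow> I <+> PIdl x \<subseteq> P i" "\<And>i. i < Suc r \<Longrightarrow> P i \<subset> P (Suc i)"
      by blast
    obtain Q where Q': "Q \<in> \<Q>" "Q \<subseteq> P 0"
      using cover[of "P 0"] P(1)[of 0] P(2)[of 0] J(2) by blast
    have "Q \<noteq> P 0"
    proof
      assume "Q = P 0"
      then have "x \<in> Q" using P(2)[of 0] J(3) by blast
      then have "Q = \<mm>" using x(2)[of Q] Q'(1) by blast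
      then show False using P(3)[of 0] prime_le_max[OF P(1)[of 1]] \<open>Q = P 0\<close> by auto
    qed
    let ?P = "case_nat Q P"
    have "primeideal (?P i) R \<and> I \<subseteq> ?P i" if "i \<le> Suc (Suc r)" for i
      using that P(1,2) J(2) Q(2,3) Q'(1) by (cases i) force+
    moreover have "?P i \<subset> ?P (Suc i)" if "i < Suc (Suc r)" for i
      using that P(3) Q'(2) \<open>Q \<noteq> P 0\<close> by (cases i) auto
    ultimately show False using Suc.prems(2) by blast
  qed
  from Suc.IH[OF J(1) this] obtain xs where xs: "length xs = r" "set xs \<subseteq> \<mm>"
    "\<forall>P. primeideal P R \<longrightarrow> I <+> PIdl x \<subseteq> P \<longrightarrow> set xs \<subseteq> P \<longrightarrow> P = \<mm>"
    by blast
  have "P = \<mm>" if "primeideal P R" "I \<subseteq> P" "set (x # xs) \<subseteq> P" for P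
    using xs(3) that add_cgenideal_minimal[OF primeideal.axioms(1)] by (metis insert_subset list.simps(15))
  then show ?case using xs x(1) by (intro exI[of _ "x # xs"]) auto
qed

text \<open>A prime over \<open>J\<close> that misses the powers of \<open>y\<close> would contain
  all parameters, hence be \<open>\<mm>\<close>. The conclusion speaks of every ideal that contains
  some power of each parameter, because this is all that is known of the ideals constructed
  later.\<close>

lemma exists_parameters_of_krull_dim:
  assumes "krull_dim R = enat r"
  obtains xs where "length xs = r" "set xs \<subseteq> \<mm>"
    and "\<And>J y. ideal J R \<Longrightarrow> (\<And>x. x \<in> set xs \<Longrightarrow> \<exists>n::nat. x [^] n \<in> J) \<Longrightarrow> y \<in> \<mm>
           \<Longrightarrow> \<exists>n::nat. y [^] n \<in> J"
proof -
  have "\<nexists>P. (\<forall>i\<le>Suc r. primeideal (P i) R \<and> {\<zero>} \<subseteq> P i) \<and> (\<forall>i<Suc r. P i \<subset> P (Suc i))"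
  proof
    assume "\<exists>P. (\<forall>i\<le>Suc r. primeideal (P i) R \<and> {\<zero>} \<subseteq> P i) \<and> (\<forall>i<Suc r. P i \<subset> P (Suc i))"
    then have "enat (Suc r) \<le> krull_dim R"
      unfolding krull_dim_def by (intro Sup_upper) blast
    then show False using assms by simp
  qed
  from exists_parameters[OF zeroideal this] obtain xs where xs: "length xs = r" "set xs \<subseteq> \<mm>"
    "\<And>P. primeideal P R \<Longrightarrow> {\<zero>} \<subseteq> P \<Longrightarrow> set xs \<subseteq> P \<Longrightarrow> P = \<mm>" by blast
  have "\<exists>n::nat. y [^] n \<in> J"
    if J: "ideal J R" "\<And>x. x \<in> set xs \<Longrightarrow> \<exists>n::nat. x [^] n \<in> J" and y: "y \<in> \<mm>" for J y
  proof (rule ccontr)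
    assume "\<nexists>n::nat. y [^] n \<in> J"
    then obtain P where P: "primeideal P R" "J \<subseteq> P" "y \<notin> P"
      using exists_prime_avoiding_powers[OF J(1)] y max_carrier by blast
    have pow: "x \<in> P" if "x \<in> carrier R" "x [^] n \<in> P" for x and n :: nat
      using that(2)
    proof (induction n)
      case 0
      then show ?case
        using ideal.one_imp_carrier[OF primeideal.axioms(1)[OF P(1)]] that(1) by simp
    next
      case (Suc n)
      then show ?case
        using primeideal.I_prime[OF P(1) _ that(1), of "x [^] n"] that(1) by auto
    qed
    have "set xs \<subseteq> P"
      using J(2) P(2) pow xs(2) max_carrier by (meson subset_iff)
    moreover have "{\<zero>} \<subseteq> P"
      using additive_subgroup.zero_closed[OF ideal.axioms(1)[OF primeideal.axioms(1)[OF P(1)]]] by simp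
    ultimately show False using xs(3)[OF P(1)] y P(3) by blast
  qed
  then show thesis using that xs(1,2) by blast
qed

text \<open>A largest ideal of the form \<open>I : b\<close> with \<open>b \<notin> I\<close> is prime.\<close>

lemma exists_socle_element:
  assumes I: "ideal I R" "I \<subset> \<mm>" and pow: "\<And>y. y \<in> \<mm> \<Longrightarrow> \<exists>n::nat. y [^] n \<in> I"
  obtains a where "a \<in> \<mm>" "a \<notin> I" "\<And>y. y \<in> \<mm> \<Longrightarrow> a \<otimes> y \<in> I"
proof -
  define K where "K b = {r \<in> carrier R. b \<otimes> r \<in> I}" for b
  have "ideal (K b) R" if "b \<in> \<mm> - I" for b
    unfolding K_def using ideal_colon[OF I(1)] that max_carrier by blast
  moreover have "K ` (\<mm> - I) \<noteq> {}" using I(2) by auto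
  ultimately have "\<exists>I'\<in>K ` (\<mm> - I). \<forall>J\<in>K ` (\<mm> - I). I' \<subseteq> J \<longrightarrow> J = I'"
    by (intro exists_maximal_in_ideals) auto
  then obtain a where a: "a \<in> \<mm> - I" and max: "\<And>b. b \<in> \<mm> - I \<Longrightarrow> K a \<subseteq> K b \<Longrightarrow> K b = K a"
    by auto
  have ac: "a \<in> carrier R" using a max_carrier by blast
  have "a \<otimes> y \<in> I" if y: "y \<in> \<mm>" for y
  proof -
    have yc: "y \<in> carrier R" using y max_carrier by blast
    have step: "a \<otimes> y [^] n \<in> I \<Longrightarrow> a \<otimes> y \<in> I" for n :: nat
    proof (induction n)
      case 0
      then show ?case using a ac by simp
    next
      case (Suc n)
      show ?case
      proof (cases "a \<otimes> y \<in> I")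
        case False
        then have "a \<otimes> y \<in> \<mm> - I" using y ac ideal_max by (simp add: ideal.I_l_closed)
        moreover have "K a \<subseteq> K (a \<otimes> y)"
        proof
          fix r assume r: "r \<in> K a"
          then have "(a \<otimes> y) \<otimes> r = y \<otimes> (a \<otimes> r)" unfolding K_def using ac yc by (simp add: m_ac)
          then show "r \<in> K (a \<otimes> y)"
            using r yc I(1) unfolding K_def by (simp add: ideal.I_l_closed)
        qed
        ultimately have "K (a \<otimes> y) = K a" by (rule max)
        moreover have "y [^] n \<in> K (a \<otimes> y)"
        proof -
          have "a \<otimes> y \<otimes> y [^] n = a \<otimes> y [^] Suc n" using ac yc by (simp add: m_ac)
          then show ?thesis using Suc.prems yc unfolding K_def by simp
        qed
        ultimately show ?thesis using Suc.IH unfolding K_def by blast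
      qed
    qed
    obtain n :: nat where "y [^] n \<in> I" using pow y by blast
    then have "a \<otimes> y [^] n \<in> I" using I(1) ac by (simp add: ideal.I_l_closed)
    then show ?thesis by (rule step)
  qed
  then show thesis using that a by blast
qed

end

section \<open>Free modules and linear maps\<close>

text \<open>Unlike the carrier of \<open>Hom_module\<close>, this leaves the values outside
  \<open>carrier M\<close> free, since differentials and their coordinate functions are not
  extensional.\<close>

definition linear_map ::
    "('a, 'm) ring_scheme \<Rightarrow> ('a, 'b, 'n) module_scheme \<Rightarrow> ('a, 'c, 'p) module_scheme
      \<Rightarrow> ('b \<Rightarrow> 'c) \<Rightarrow> bool" where
  "linear_map R M N h \<longleftrightarrow>
     h \<in> carrier M \<rightarrow> carrier N \<and>
     (\<forall>x\<in>carrier M. \<forall>y\<in>carrier M. h (x \<oplus>\<^bsub>M\<^esub> y) = h x \<oplus>\<^bsub>N\<^esub> h y) \<and>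
     (\<forall>r\<in>carrier R. \<forall>x\<in>carrier M. h (r \<odot>\<^bsub>M\<^esub> x) = r \<odot>\<^bsub>N\<^esub> h x)"

lemma linear_mapI:
  assumes "\<And>x. x \<in> carrier M \<Longrightarrow> h x \<in> carrier N"
    and "\<And>x y. x \<in> carrier M \<Longrightarrow> y \<in> carrier M \<Longrightarrow> h (x \<oplus>\<^bsub>M\<^esub> y) = h x \<oplus>\<^bsub>N\<^esub> h y"
    and "\<And>r x. r \<in> carrier R \<Longrightarrow> x \<in> carrier M \<Longrightarrow> h (r \<odot>\<^bsub>M\<^esub> x) = r \<odot>\<^bsub>N\<^esub> h x"
  shows "linear_map R M N h"
  using assms unfolding linear_map_def by auto

lemma linear_mapD:
  assumes "linear_map R M N h"
  shows "x \<in> carrier M \<Longrightarrow> h x \<in> carrier N"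
    and "x \<in> carrier M \<Longrightarrow> y \<in> carrier M \<Longrightarrow> h (x \<oplus>\<^bsub>M\<^esub> y) = h x \<oplus>\<^bsub>N\<^esub> h y"
    and "r \<in> carrier R \<Longrightarrow> x \<in> carrier M \<Longrightarrow> h (r \<odot>\<^bsub>M\<^esub> x) = r \<odot>\<^bsub>N\<^esub> h x"
  using assms unfolding linear_map_def by auto

lemma linear_map_zero:
  assumes "module R M" "module R N" "linear_map R M N h"
  shows "h \<zero>\<^bsub>M\<^esub> = \<zero>\<^bsub>N\<^esub>"
proof -
  interpret M: module R M by fact
  interpret N: module R N by fact
  have "h (\<zero>\<^bsub>R\<^esub> \<odot>\<^bsub>M\<^esub> \<zero>\<^bsub>M\<^esub>) = \<zero>\<^bsub>R\<^esub> \<odot>\<^bsub>N\<^esub> h \<zero>\<^bsub>M\<^esub>"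
    using linear_mapD(3)[OF assms(3), of "\<zero>\<^bsub>R\<^esub>" "\<zero>\<^bsub>M\<^esub>"] by blast
  then show ?thesis using linear_mapD(1)[OF assms(3), of "\<zero>\<^bsub>M\<^esub>"] by simp
qed

lemma self_module_simps [simp]:
  "carrier (self_module R) = carrier R" "\<zero>\<^bsub>self_module R\<^esub> = \<zero>\<^bsub>R\<^esub>"
  "x \<oplus>\<^bsub>self_module R\<^esub> y = x \<oplus>\<^bsub>R\<^esub> y" "r \<odot>\<^bsub>self_module R\<^esub> x = r \<otimes>\<^bsub>R\<^esub> x"
  by (simp_all add: self_module_def)

lemma functionalD:
  assumes "linear_map R M (self_module R) \<phi>"
  shows "x \<in> carrier M \<Longrightarrow> \<phi> x \<in> carrier R"
    and "x \<in> carrier M \<Longrightarrow> y \<in> carrier M \<Longrightarrow> \<phi> (x \<oplus>\<^bsub>M\<^esub> y) = \<phi> x \<oplus>\<^bsub>R\<^esub> \<phi> y"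
    and "r \<in> carrier R \<Longrightarrow> x \<in> carrier M \<Longrightarrow> \<phi> (r \<odot>\<^bsub>M\<^esub> x) = r \<otimes>\<^bsub>R\<^esub> \<phi> x"
  using linear_mapD[OF assms] by simp_all

section \<open>Arithmetic in free modules and functionals on them\<close>

lemma free_module_simps [simp]:
  "f \<in> carrier (free_module R S) \<longleftrightarrow>
     (\<forall>s\<in>S. f s \<in> carrier R) \<and> (\<forall>s. s \<notin> S \<longrightarrow> f s = \<zero>\<^bsub>R\<^esub>) \<and> finite {s. f s \<noteq> \<zero>\<^bsub>R\<^esub>}"
  "\<zero>\<^bsub>free_module R S\<^esub> = (\<lambda>_. \<zero>\<^bsub>R\<^esub>)"
  "f \<oplus>\<^bsub>free_module R S\<^esub> g = (\<lambda>s. f s \<oplus>\<^bsub>R\<^esub> g s)"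
  "r \<odot>\<^bsub>free_module R S\<^esub> f = (\<lambda>s. r \<otimes>\<^bsub>R\<^esub> f s)"
  by (simp_all add: free_module_def)

declare free_module_simps(1) [simp del]

context cring
begin

lemma module_self: "module R (self_module R)"
  by (rule moduleI[OF is_cring], rule abelian_groupI)
    (auto simp: l_distr r_distr m_assoc a_ac intro: bexI[of _ "\<ominus> x" for x] r_neg)

lemma free_module_closed: "f \<in> carrier (free_module R S) \<Longrightarrow> f s \<in> carrier R"
  by (cases "s \<in> S") (auto simp: free_module_simps(1))

lemma free_moduleI:
  assumes "\<And>s. f s \<in> carrier R" and "\<And>s. g s = \<zero> \<Longrightarrow> f s = \<zero>" and "g \<in> carrier (free_module R S)"
  shows "f \<in> carrier (free_module R S)"
proof -
  have "{s. f s \<noteq> \<zero>} \<subseteq> {s. g s \<noteq> \<zero>}" using assms(2) by auto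
  then show ?thesis
    using assms by (auto simp: free_module_simps(1) intro: finite_subset)
qed

lemma free_module_add:
  assumes "f \<in> carrier (free_module R S)" "g \<in> carrier (free_module R S)"
  shows "(\<lambda>s. f s \<oplus> g s) \<in> carrier (free_module R S)"
proof -
  have "{s. f s \<oplus> g s \<noteq> \<zero>} \<subseteq> {s. f s \<noteq> \<zero>} \<union> {s. g s \<noteq> \<zero>}" by auto
  then show ?thesis
    using assms by (auto simp: free_module_simps(1) intro: finite_subset)
qed

lemma free_module_smult:
  assumes "r \<in> carrier R" "f \<in> carrier (free_module R S)"
  shows "(\<lambda>s. r \<otimes> f s) \<in> carrier (free_module R S)"
  using assms by (intro free_moduleI[OF _ _ assms(2)]) (auto dest: free_module_closed)

lemma module_free: "module R (free_module R S)"
proof (rule moduleI[OF is_cring], rule abelian_groupI)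
  fix f assume f: "f \<in> carrier (free_module R S)"
  have "(\<lambda>s. \<ominus> f s) \<in> carrier (free_module R S)"
    using f by (intro free_moduleI[OF _ _ f]) (auto dest: free_module_closed)
  moreover have "(\<lambda>s. \<ominus> f s) \<oplus>\<^bsub>free_module R S\<^esub> f = \<zero>\<^bsub>free_module R S\<^esub>"
    using free_module_closed[OF f] by (simp add: l_neg)
  ultimately show "\<exists>g\<in>carrier (free_module R S). g \<oplus>\<^bsub>free_module R S\<^esub> f = \<zero>\<^bsub>free_module R S\<^esub>"
    by blast
next
  show "\<zero>\<^bsub>free_module R S\<^esub> \<in> carrier (free_module R S)"
    by (simp add: free_module_simps(1))
qed (simp_all add: free_module_closed free_module_add free_module_smult
      a_ac m_assoc l_distr r_distr)

lemma free_module_a_inv: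
  assumes "f \<in> carrier (free_module R S)"
  shows "\<ominus>\<^bsub>free_module R S\<^esub> f = (\<lambda>s. \<ominus> f s)"
proof -
  interpret F: module R "free_module R S" by (rule module_free)
  have "\<ominus>\<^bsub>free_module R S\<^esub> f = (\<ominus> \<one>) \<odot>\<^bsub>free_module R S\<^esub> f"
    using F.smult_l_minus[OF one_closed assms] F.smult_one[OF assms] by metis
  then show ?thesis using free_module_closed[OF assms] by (simp add: l_minus)
qed

lemma basis_vec_closed: "s \<in> S \<Longrightarrow> basis_vec R s \<in> carrier (free_module R S)"
  by (auto simp: free_module_simps(1) basis_vec_def intro: finite_subset[of _ "{s}"])

text \<open>Induction on the support. Because of \<open>f s = \<zero>\<close> each step adds a
  coefficient at a fresh basis element, so that a condition on all coefficients of the sum passes to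
  \<open>f\<close> and to \<open>r\<close> separately.\<close>

lemma free_module_induct [consumes 1, case_names zero add]:
  assumes "f \<in> carrier (free_module R S)"
    and zero: "P (\<lambda>_. \<zero>)"
    and add: "\<And>f s r. f \<in> carrier (free_module R S) \<Longrightarrow> P f \<Longrightarrow> s \<in> S \<Longrightarrow> f s = \<zero> \<Longrightarrow> r \<in> carrier R
      \<Longrightarrow> P (f \<oplus>\<^bsub>free_module R S\<^esub> (r \<odot>\<^bsub>free_module R S\<^esub> basis_vec R s))"
  shows "P f"
proof -
  have "P f" if "finite A" "f \<in> carrier (free_module R S)" "{s. f s \<noteq> \<zero>} = A" for A f
    using that
  proof (induction A arbitrary: f)
    case empty
    then have "f = (\<lambda>_. \<zero>)" by auto
    then show ?case using zero by simp
  next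
    case (insert s A)
    let ?g = "f(s := \<zero>)"
    have g: "?g \<in> carrier (free_module R S)"
      using insert.prems(1) by (intro free_moduleI[OF _ _ insert.prems(1)]) (auto dest: free_module_closed)
    have s: "s \<in> S" using insert.prems by (auto simp: free_module_simps(1))
    have "{t. ?g t \<noteq> \<zero>} = A" using insert.prems(2) insert.hyps(2) by auto
    then have "P ?g" by (rule insert.IH[OF g])
    then have "P (?g \<oplus>\<^bsub>free_module R S\<^esub> (f s \<odot>\<^bsub>free_module R S\<^esub> basis_vec R s))"
      using add[OF g _ s _ free_module_closed[OF insert.prems(1)]] by simp
    also have "?g \<oplus>\<^bsub>free_module R S\<^esub> (f s \<odot>\<^bsub>free_module R S\<^esub> basis_vec R s) = f"
      using free_module_closed[OF insert.prems(1)] by (auto simp: basis_vec_def fun_eq_iff)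
    finally show ?case .
  qed
  moreover have "finite {s. f s \<noteq> \<zero>}" using assms(1) unfolding free_module_simps(1) by blast
  ultimately show ?thesis using assms(1) by blast
qed

text \<open>The value \<open>l u\<close> is a linear combination of the coefficients of
  \<open>u\<close>.\<close>

lemma functional_in_ideal:
  assumes lin: "linear_map R (free_module R S) (self_module R) l" and J: "ideal J R"
    and u: "u \<in> carrier (free_module R S)" "\<And>s. u s \<in> J"
  shows "l u \<in> J"
proof -
  interpret J: ideal J R by fact
  interpret F: module R "free_module R S" by (rule module_free)
  have "(\<forall>s. u s \<in> J) \<longrightarrow> l u \<in> J"
    using u(1)
  proof (induction u rule: free_module_induct)
    case zero
    then show ?case using linear_map_zero[OF module_free module_self lin] by simp
  next
    case (add f s r)
    show ?case
    proof (intro impI)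
      assume vals: "\<forall>t. (f \<oplus>\<^bsub>free_module R S\<^esub> (r \<odot>\<^bsub>free_module R S\<^esub> basis_vec R s)) t \<in> J"
      have "r \<in> J" using vals[rule_format, of s] add.hyps by (simp add: basis_vec_def)
      moreover have "f t \<in> J" for t
        using vals[rule_format, of t] add.hyps free_module_closed[OF add.hyps(1), of t]
        by (cases "t = s") (auto simp: basis_vec_def)
      moreover have "l (basis_vec R s) \<in> carrier R"
        using linear_mapD(1)[OF lin] basis_vec_closed[OF add.hyps(2)] by simp
      ultimately show "l (f \<oplus>\<^bsub>free_module R S\<^esub> (r \<odot>\<^bsub>free_module R S\<^esub> basis_vec R s)) \<in> J"
        using linear_mapD(2)[OF lin add.hyps(1) F.smult_closed[OF add.hyps(4) basis_vec_closed[OF add.hyps(2)]]]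
          linear_mapD(3)[OF lin add.hyps(4) basis_vec_closed[OF add.hyps(2)]] add.IH
        by (simp add: J.I_r_closed del: free_module_simps)
    qed
  qed
  then show ?thesis using u(2) by blast
qed

lemma free_module_split:
  assumes f: "f \<in> carrier (free_module R S)" and a: "a \<in> carrier R" and I: "ideal I R"
    and vals: "\<And>s. f s \<in> I <+> PIdl a"
  obtains u h where "u \<in> carrier (free_module R S)" "h \<in> carrier (free_module R S)"
    "\<And>s. u s \<in> I" "\<And>s. f s = u s \<oplus> a \<otimes> h s"
proof -
  \<comment> \<open>Forcing the pair to be zero wherever \<open>f\<close> vanishes keeps both chosen
    families finitely supported.\<close>
  have "\<exists>p. fst p \<in> I \<and> snd p \<in> carrier R \<and> f s = fst p \<oplus> a \<otimes> snd p
      \<and> (f s = \<zero> \<longrightarrow> p = (\<zero>, \<zero>))" (is "\<exists>p. ?P s p") for s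
  proof (cases "f s = \<zero>")
    case True
    then show ?thesis
      using a additive_subgroup.zero_closed[OF ideal.axioms(1)[OF I]] by (intro exI[of _ "(\<zero>, \<zero>)"]) auto
  next
    case False
    then show ?thesis using vals[of s] unfolding mem_add_cgenideal[OF a] by auto
  qed
  then have "\<exists>p. \<forall>s. ?P s (p s)" by (intro choice allI)
  then obtain p where p: "\<And>s. ?P s (p s)" by blast
  have p0: "fst (p s) = \<zero>" "snd (p s) = \<zero>" if "f s = \<zero>" for s
  proof -
    have "p s = (\<zero>, \<zero>)" using p[of s] that by blast
    then show "fst (p s) = \<zero>" "snd (p s) = \<zero>" by simp_all
  qed
  have pc: "fst (p s) \<in> I" "fst (p s) \<in> carrier R" "snd (p s) \<in> carrier R" for s
    using p[of s] ideal.Icarr[OF I] by blast+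
  show thesis
  proof (rule that)
    show "(\<lambda>s. fst (p s)) \<in> carrier (free_module R S)"
      using pc(2) p0(1) by (rule free_moduleI[OF _ _ f])
    show "(\<lambda>s. snd (p s)) \<in> carrier (free_module R S)"
      using pc(3) p0(2) by (rule free_moduleI[OF _ _ f])
    show "fst (p s) \<in> I" "f s = fst (p s) \<oplus> a \<otimes> snd (p s)" for s using p[of s] by blast+
  qed
qed

end

section \<open>Rigidity for complexes of free modules\<close>

text \<open>
  The functionals in \<open>\<Lambda> (Suc n)\<close> are the coordinates of the differential out of degree \<open>n + 1\<close>,
  while \<open>\<Lambda> 0\<close> plays the role of a differential from degree \<open>0\<close> into a product \<open>P\<^sub>0\<close> of copies of
  \<open>R\<close>. Thus \<open>Z n J\<close> consists of the chains that become cycles modulo \<open>J\<close>, and \<open>fills n I g\<close> says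
  that \<open>g\<close> is a boundary modulo \<open>I\<close>. In the application \<open>P\<^sub>0\<close> is followed by a second product \<open>P\<^sub>1\<close>
  of copies of \<open>R\<close>, with cokernel \<open>X\<close>, so that degree \<open>n\<close> computes \<open>Tor\<^sub>n\<^sub>+\<^sub>2(X, -)\<close>. The last
  assumption is the only trace of \<open>P\<^sub>1\<close>.
\<close>

locale free_resolution = noetherian_local_cring R \<mm> for R (structure) and \<mm> +
  fixes S :: "nat \<Rightarrow> 's set" and d :: "nat \<Rightarrow> ('s \<Rightarrow> 'a) \<Rightarrow> 's \<Rightarrow> 'a"
    and \<Lambda> :: "nat \<Rightarrow> (('s \<Rightarrow> 'a) \<Rightarrow> 'a) set"
  assumes functional_linear:
      "l \<in> \<Lambda> n \<Longrightarrow> linear_map R (free_module R (S n)) (self_module R) l"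
    and diff_linear: "linear_map R (free_module R (S (Suc n))) (free_module R (S n)) (d n)"
    and functional_Suc: "\<Lambda> (Suc n) = range (\<lambda>s g. d n g s)"
    and exact: "g \<in> carrier (free_module R (S n)) \<Longrightarrow>
      (\<forall>l\<in>\<Lambda> n. l g = \<zero>) \<longleftrightarrow> g \<in> d n ` carrier (free_module R (S (Suc n)))"
    and power_multiple: "\<lbrakk>y \<in> carrier R;
      \<And>(k::nat) r. r \<in> carrier R \<Longrightarrow> y [^] k \<otimes> r = \<zero> \<Longrightarrow> y [^] c \<otimes> r = \<zero>;
      g \<in> carrier (free_module R (S 0)); \<And>l. l \<in> \<Lambda> 0 \<Longrightarrow> l g \<in> PIdl (y [^] (c + t))\<rbrakk>
      \<Longrightarrow> \<exists>e\<in>carrier (free_module R (S (Suc 0))). \<exists>h\<in>carrier (free_module R (S 0)).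
            \<forall>s. g s = d 0 e s \<oplus> y [^] (t::nat) \<otimes> h s"
begin

abbreviation F :: "nat \<Rightarrow> ('s \<Rightarrow> 'a) set" where
  "F n \<equiv> carrier (free_module R (S n))"

definition Z :: "nat \<Rightarrow> 'a set \<Rightarrow> ('s \<Rightarrow> 'a) set" where
  "Z n J = {g \<in> F n. \<forall>l\<in>\<Lambda> n. l g \<in> J}"

definition fills :: "nat \<Rightarrow> 'a set \<Rightarrow> ('s \<Rightarrow> 'a) \<Rightarrow> bool" where
  "fills n I g \<longleftrightarrow>
     (\<exists>e\<in>F (Suc n). \<exists>v\<in>F n. (\<forall>s. v s \<in> I) \<and> (\<forall>s. g s = d n e s \<oplus> v s))"

lemma Z_Suc: "Z (Suc n) J = {g \<in> F (Suc n). \<forall>s. d n g s \<in> J}"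
  unfolding Z_def functional_Suc by auto

lemma diff_closed: "e \<in> F (Suc n) \<Longrightarrow> d n e \<in> F n"
  using linear_mapD(1)[OF diff_linear] .

lemma coeff_closed: "g \<in> F n \<Longrightarrow> g s \<in> carrier R"
  by (rule free_module_closed)

text \<open>Since \<open>l\<close> kills boundaries, applying it to \<open>eq\<close> gives
  \<open>a \<otimes> l h = \<ominus> l u\<close>. Thus \<open>h\<close> is a cycle modulo
  \<open>J : a\<close>; the passage from \<open>g\<close> to \<open>h\<close> is the connecting
  homomorphism of \<open>0 \<rightarrow> R/(J : a) \<rightarrow> R/J \<rightarrow> R/(J + aR)
  \<rightarrow> 0\<close>, whose first map is multiplication by \<open>a\<close>.\<close>

lemma functional_boundary:
  assumes g: "g \<in> F (Suc n)" and l: "l \<in> \<Lambda> n" and J: "ideal J R"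
    and u: "u \<in> F n" "\<And>s. u s \<in> J" and a: "a \<in> carrier R" and h: "h \<in> F n"
    and eq: "\<And>s. d n g s = u s \<oplus> a \<otimes> h s"
  shows "a \<otimes> l h \<in> J"
proof -
  interpret J: ideal J R by fact
  note lin = functional_linear[OF l]
  have "l (d n g) = \<zero>"
    using exact[OF diff_closed[OF g]] g l by blast
  moreover have "l (d n g) = l u \<oplus> a \<otimes> l h"
  proof -
    have "d n g = u \<oplus>\<^bsub>free_module R (S n)\<^esub> (a \<odot>\<^bsub>free_module R (S n)\<^esub> h)"
      using eq by auto
    then show ?thesis
      using linear_mapD(2)[OF lin u(1), of "a \<odot>\<^bsub>free_module R (S n)\<^esub> h"] linear_mapD(3)[OF lin a h]
        free_module_smult[OF a h] by simp
  qed
  moreover have "l u \<in> J" by (rule functional_in_ideal[OF lin J u])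
  moreover have "l h \<in> carrier R" using linear_mapD(1)[OF lin h] by simp
  ultimately have "a \<otimes> l h = \<ominus> l u"
    using a J.Icarr[OF \<open>l u \<in> J\<close>] sum_zero_eq_neg[of "a \<otimes> l h" "l u"] by (simp add: a_comm)
  then show ?thesis using \<open>l u \<in> J\<close> by simp
qed

text \<open>The counterpart of \<open>functional_boundary\<close> on chains: once the obstruction is
  a boundary up to a \<open>v\<close> that \<open>b\<close> multiplies into \<open>J\<close>,
  subtracting \<open>b \<otimes> e\<close> from \<open>g\<close> cancels
  \<open>b \<otimes> d n e\<close> and leaves a differential with all coefficients in
  \<open>J\<close>.\<close>

lemma correct_by_multiple:
  assumes g: "g \<in> F (Suc n)" and e: "e \<in> F (Suc n)" and b: "b \<in> carrier R" and J: "ideal J R"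
    and u: "\<And>s. u s \<in> J" and v: "v \<in> F n" "\<And>s. b \<otimes> v s \<in> J"
    and eq: "\<And>s. d n g s = u s \<oplus> b \<otimes> (d n e s \<oplus> v s)"
  obtains g' where "g' \<in> Z (Suc n) J" "\<And>s. g s = g' s \<oplus> b \<otimes> e s"
proof
  let ?F = "free_module R (S (Suc n))"
  let ?g = "g \<oplus>\<^bsub>?F\<^esub> ((\<ominus> b) \<odot>\<^bsub>?F\<^esub> e)"
  interpret J: ideal J R by fact
  have be: "(\<ominus> b) \<odot>\<^bsub>?F\<^esub> e \<in> F (Suc n)"
    using free_module_smult[OF _ e, of "\<ominus> b"] b by simp
  have "d n ?g s = u s \<oplus> b \<otimes> v s" for s
  proof -
    have "d n ?g s = d n g s \<oplus> (\<ominus> b) \<otimes> d n e s"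
      using linear_mapD(2)[OF diff_linear g be] linear_mapD(3)[OF diff_linear _ e, of "\<ominus> b"] b
      by simp
    also have "\<dots> = u s \<oplus> b \<otimes> v s \<oplus> (b \<otimes> d n e s \<oplus> \<ominus> (b \<otimes> d n e s))"
      using eq J.Icarr[OF u] b coeff_closed[OF diff_closed[OF e]] coeff_closed[OF v(1)]
      by (simp add: r_distr l_minus a_ac)
    also have "\<dots> = u s \<oplus> b \<otimes> v s"
      using J.Icarr[OF u] b coeff_closed[OF diff_closed[OF e]] coeff_closed[OF v(1)]
      by (simp add: r_neg)
    finally show ?thesis .
  qed
  moreover have "?g \<in> F (Suc n)" using free_module_add[OF g be] by simp
  ultimately show "?g \<in> Z (Suc n) J"
    unfolding Z_Suc using u v(2) by auto
  show "g s = ?g s \<oplus> b \<otimes> e s" for s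
    using b coeff_closed[OF g] coeff_closed[OF e] by (simp add: l_minus a_assoc l_neg)
qed

lemma fills_add:
  assumes "fills n I g'" "h \<in> F n" "\<And>s. h s \<in> I" "ideal I R" "\<And>s. g s = g' s \<oplus> h s"
  shows "fills n I g"
proof -
  obtain e v where e: "e \<in> F (Suc n)" and v: "v \<in> F n" "\<And>s. v s \<in> I"
    and g': "\<And>s. g' s = d n e s \<oplus> v s"
    using assms(1) unfolding fills_def by blast
  have "g s = d n e s \<oplus> (v s \<oplus> h s)" for s
    using assms(5) g' coeff_closed[OF v(1)] coeff_closed[OF assms(2)] coeff_closed[OF diff_closed[OF e]]
    by (simp add: a_assoc)
  moreover have "v s \<oplus> h s \<in> I" for s
    using v(2) assms(3) additive_subgroup.a_closed[OF ideal.axioms(1)[OF assms(4)]] by blast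
  ultimately show ?thesis
    unfolding fills_def using e free_module_add[OF v(1) assms(2)]
    by (intro bexI[of _ e] bexI[of _ "\<lambda>s. v s \<oplus> h s"]) auto
qed

text \<open>
  The surjectivity of \<open>Tor\<^sub>n\<^sub>+\<^sub>1(M, R/J) \<rightarrow> Tor\<^sub>n\<^sub>+\<^sub>1(M, R/\<mm>)\<close> when \<open>Tor\<^sub>n(M, R/\<mm>) = 0\<close>
  and \<open>R/J\<close> has finite length.
\<close>

lemma lift_cycle_to_primary_ideal:
  assumes fills: "\<And>g. g \<in> Z n \<mm> \<Longrightarrow> fills n \<mm> g"
    and "ideal J R" "J \<subseteq> \<mm>" "\<And>y. y \<in> \<mm> \<Longrightarrow> \<exists>k::nat. y [^] k \<in> J"
    and g: "g \<in> Z (Suc n) \<mm>"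
  shows "\<exists>g'\<in>Z (Suc n) J. \<exists>h\<in>F (Suc n). (\<forall>s. h s \<in> \<mm>) \<and> (\<forall>s. g s = g' s \<oplus> h s)"
  using assms(2-4)
proof (induction J rule: noetherian_induct)
  case (1 J)
  show ?case
  proof (cases "J = \<mm>")
    case True
    have "g \<in> F (Suc n)" using g unfolding Z_def by blast
    then show ?thesis
      using True g module.carrier_is_submodule[OF module_free] coeff_closed
        additive_subgroup.zero_closed[OF ideal.axioms(1)[OF ideal_max]]
      by (intro bexI[of _ g] bexI[of _ "\<lambda>_. \<zero>"]) (auto simp: free_module_simps(1))
  next
    case False
    \<comment> \<open>The class of \<open>a\<close> spans a copy of \<open>k\<close> inside
      \<open>\<mm>/J\<close>, so \<open>J : a\<close> equals \<open>\<mm>\<close>. The obstruction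
      to lifting a cycle from \<open>J <+> PIdl a\<close> to \<open>J\<close> is therefore a cycle
      modulo \<open>\<mm>\<close>, to which \<open>fills\<close> applies.\<close>
    then obtain a where a: "a \<in> \<mm>" "a \<notin> J" "\<And>y. y \<in> \<mm> \<Longrightarrow> a \<otimes> y \<in> J"
      using exists_socle_element[OF 1(1)] 1(3,4) by blast
    have ac: "a \<in> carrier R" using a max_carrier by blast
    note J1 = add_cgenideal[OF 1(1) ac]
    have "J \<subset> J <+> PIdl a" using J1 a(2) by blast
    moreover have "J <+> PIdl a \<subseteq> \<mm>"
      using add_cgenideal_minimal[OF ideal_max 1(3) a(1)] .
    moreover have "\<exists>k::nat. y [^] k \<in> J <+> PIdl a" if "y \<in> \<mm>" for y
      using 1(4)[OF that] J1(2) by blast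
    ultimately obtain g1 h1 where g1: "g1 \<in> Z (Suc n) (J <+> PIdl a)"
      and h1: "h1 \<in> F (Suc n)" "\<And>s. h1 s \<in> \<mm>" and gg1: "\<And>s. g s = g1 s \<oplus> h1 s"
      using 1(2)[OF J1(1)] by blast
    have g1F: "g1 \<in> F (Suc n)" and "\<And>s. d n g1 s \<in> J <+> PIdl a"
      using g1 unfolding Z_Suc by auto
    then obtain u h where u: "u \<in> F n" "\<And>s. u s \<in> J" and h: "h \<in> F n"
      and dg1: "\<And>s. d n g1 s = u s \<oplus> a \<otimes> h s"
      using free_module_split[OF diff_closed[OF g1F] ac 1(1)] by metis
    have "l h \<in> \<mm>" if l: "l \<in> \<Lambda> n" for l
    proof -
      have lh: "l h \<in> carrier R" using linear_mapD(1)[OF functional_linear[OF l] h] by simp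
      let ?K = "{r \<in> carrier R. a \<otimes> r \<in> J}"
      have "?K \<noteq> carrier R"
        using a(2) one_closed r_one[OF ac] by force
      then have "?K \<subseteq> \<mm>"
        by (rule proper_ideal_le_max[OF ideal_colon[OF 1(1) ac]])
      then show ?thesis
        using functional_boundary[OF g1F l 1(1) u ac h dg1] lh by blast
    qed
    then have "fills n \<mm> h" using fills h unfolding Z_def by blast
    then obtain e v where e: "e \<in> F (Suc n)" and v: "v \<in> F n" "\<And>s. v s \<in> \<mm>"
      and hev: "\<And>s. h s = d n e s \<oplus> v s"
      unfolding fills_def by blast
    have "d n g1 s = u s \<oplus> a \<otimes> (d n e s \<oplus> v s)" for s
      using dg1 hev by simp
    then obtain g2 where g2: "g2 \<in> Z (Suc n) J" and g12: "\<And>s. g1 s = g2 s \<oplus> a \<otimes> e s"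
      using correct_by_multiple[where u = u, OF g1F e ac 1(1) u(2) v(1) a(3)[OF v(2)]] by blast
    have g2c: "g2 s \<in> carrier R" for s
      using g2 coeff_closed unfolding Z_def by blast
    \<comment> \<open>The correction by \<open>a \<otimes> e s\<close> does not change the class
      modulo \<open>\<mm>\<close>, as the socle element lies in \<open>\<mm>\<close>.\<close>
    let ?h = "\<lambda>s. a \<otimes> e s \<oplus> h1 s"
    have "?h \<in> F (Suc n)" using free_module_add[OF free_module_smult[OF ac e] h1(1)] .
    moreover have "?h s \<in> \<mm>" for s
      using a(1) coeff_closed[OF e] h1(2) ideal_max
      by (simp add: ideal.I_r_closed additive_subgroup.a_closed[OF ideal.axioms(1)])
    moreover have "g s = g2 s \<oplus> ?h s" for s
      using gg1 g12 g2c ac coeff_closed[OF e] coeff_closed[OF h1(1)] by (simp add: a_assoc)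
    ultimately show ?thesis using g2 by (intro bexI[of _ g2] bexI[of _ ?h]) auto
  qed
qed

text \<open>
  A uniform form of the vanishing of local cohomology in degrees above the number of generators:
  the maps \<open>Tor\<^sub>j(X, R/J) \<rightarrow> Tor\<^sub>j(X, R/I)\<close> are zero for \<open>j > length xs\<close>, where \<open>X\<close> is as above.
  The ideals \<open>J : y\<^sup>k\<close> are stationary from \<open>k = c\<close> on, so that \<open>d g \<equiv> y\<^bsup>c + t\<^esup> h\<close> modulo \<open>J\<close> makes
  \<open>y\<^sup>c h\<close> a cycle modulo \<open>J\<close>, to which the case of one generator less applies.
\<close>

lemma fills_of_power_cycle:
  assumes "set xs \<subseteq> carrier R" "ideal I R" "\<And>x. x \<in> set xs \<Longrightarrow> \<exists>k::nat. x [^] k \<in> I"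
  shows "\<exists>J. ideal J R \<and> J \<subseteq> I \<and> (\<forall>x\<in>set xs. \<exists>k::nat. x [^] k \<in> J) \<and> (xs = [] \<longrightarrow> J = {\<zero>})
           \<and> (\<forall>n. length xs \<le> Suc n \<longrightarrow> (\<forall>g\<in>Z n J. fills n I g))"
  using assms
proof (induction xs arbitrary: I)
  case Nil
  interpret I: ideal I R by fact
  have "fills n I g" if "g \<in> Z n {\<zero>}" for n g
  proof -
    have "g \<in> F n" "\<forall>l\<in>\<Lambda> n. l g = \<zero>" using that unfolding Z_def by auto
    then obtain e where "e \<in> F (Suc n)" "g = d n e" using exact by blast
    then show ?thesis
      unfolding fills_def using coeff_closed[OF \<open>g \<in> F n\<close>]
      by (intro bexI[of _ e] bexI[of _ "\<lambda>_. \<zero>"]) (auto simp: free_module_simps(1))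
  qed
  then show ?case using zeroideal by (intro exI[of _ "{\<zero>}"]) auto
next
  case (Cons y xs)
  have y: "y \<in> carrier R" and xs: "set xs \<subseteq> carrier R" using Cons.prems(1) by auto
  obtain t :: nat where t: "y [^] t \<in> I" using Cons.prems(3) by auto
  have "\<And>x. x \<in> set xs \<Longrightarrow> \<exists>k::nat. x [^] k \<in> I" using Cons.prems(3) by auto
  \<comment> \<open>Two descents are needed: from \<open>J'\<close> to \<open>I\<close> for the
    corrected cycle in degree \<open>n\<close>, and from \<open>J\<close> to \<open>J'\<close> for
    the obstruction one degree lower.\<close>
  from Cons.IH[OF xs Cons.prems(2) this]
  obtain J' where J': "ideal J' R" "J' \<subseteq> I" "\<And>x. x \<in> set xs \<Longrightarrow> \<exists>k::nat. x [^] k \<in> J'"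
    and fillsI: "\<And>n g. length xs \<le> Suc n \<Longrightarrow> g \<in> Z n J' \<Longrightarrow> fills n I g"
    by auto
  from Cons.IH[OF xs J'(1,3)]
  obtain J where J: "ideal J R" "J \<subseteq> J'" "\<And>x. x \<in> set xs \<Longrightarrow> \<exists>k::nat. x [^] k \<in> J"
    and Nil: "xs = [] \<Longrightarrow> J = {\<zero>}"
    and fillsJ': "\<And>n g. length xs \<le> Suc n \<Longrightarrow> g \<in> Z n J \<Longrightarrow> fills n J' g"
    by auto
  obtain c :: nat where c: "\<And>(k::nat) r. r \<in> carrier R \<Longrightarrow> y [^] k \<otimes> r \<in> J \<Longrightarrow> y [^] c \<otimes> r \<in> J"
    using colon_power_stabilizes[OF J(1) y] by blast
  \<comment> \<open>The part \<open>c\<close> turns the obstruction into a cycle modulo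
    \<open>J\<close>; the part \<open>t\<close> puts the later correction by
    \<open>y [^] t \<otimes> e s\<close> into \<open>I\<close>.\<close>
  let ?b = "y [^] (c + t)"
  let ?J = "J <+> PIdl ?b"
  have bc: "?b \<in> carrier R" using y by simp
  have b: "?b = y [^] t \<otimes> y [^] c" using y by (simp add: nat_pow_mult add.commute)
  have "fills n I g" if n: "length (y # xs) \<le> Suc n" and g: "g \<in> Z n ?J" for n g
  proof (cases n)
    \<comment> \<open>In degree \<open>0\<close> the list \<open>xs\<close> is empty, whence
      \<open>J = {\<zero>}\<close>. The obstruction would live one degree lower, in the map from
      \<open>P\<^sub>0\<close> to \<open>P\<^sub>1\<close>; \<open>power_multiple\<close> takes the
      place of the inductive argument there.\<close>
    case 0
    then have "J = {\<zero>}" using n Nil by simp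
    have "z \<in> PIdl ?b" if "z \<in> ?J" for z
    proof -
      obtain r where "r \<in> carrier R" "z = \<zero> \<oplus> ?b \<otimes> r"
        using \<open>z \<in> ?J\<close> unfolding mem_add_cgenideal[OF bc] \<open>J = {\<zero>}\<close> by blast
      then show ?thesis unfolding cgenideal_def using bc m_comm by auto
    qed
    then have "g \<in> F 0" "\<And>l. l \<in> \<Lambda> 0 \<Longrightarrow> l g \<in> PIdl ?b" using g unfolding Z_def 0 by auto
    then obtain e h where e: "e \<in> F (Suc 0)" and h: "h \<in> F 0"
      and eq: "\<And>s. g s = d 0 e s \<oplus> y [^] t \<otimes> h s"
      using power_multiple[of y c g t] y c \<open>J = {\<zero>}\<close> by auto
    have "y [^] t \<otimes> h s \<in> I" for s
      using t coeff_closed[OF h] Cons.prems(2) by (simp add: ideal.I_r_closed)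
    then show ?thesis
      unfolding fills_def 0 using e eq free_module_smult[OF _ h, of "y [^] t"] y by fastforce
  next
    case (Suc k)
    then have k: "length xs \<le> Suc k" "length xs \<le> Suc n" using n by auto
    have gF: "g \<in> F (Suc k)" and "\<And>s. d k g s \<in> ?J"
      using g unfolding Suc Z_Suc by auto
    then obtain u h where u: "u \<in> F k" "\<And>s. u s \<in> J" and h: "h \<in> F k"
      and dg: "\<And>s. d k g s = u s \<oplus> ?b \<otimes> h s"
      using free_module_split[OF diff_closed[OF gF] bc J(1)] by metis
    have yc: "y [^] c \<in> carrier R" and yt: "y [^] t \<in> carrier R" using y by auto
    have "(\<lambda>s. y [^] c \<otimes> h s) \<in> Z k J"
    proof -
      have "l (\<lambda>s. y [^] c \<otimes> h s) \<in> J" if l: "l \<in> \<Lambda> k" for l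
      proof -
        have "l (\<lambda>s. y [^] c \<otimes> h s) = y [^] c \<otimes> l h"
          using linear_mapD(3)[OF functional_linear[OF l] yc h] by simp
        moreover have "l h \<in> carrier R" using linear_mapD(1)[OF functional_linear[OF l] h] by simp
        ultimately show ?thesis
          using c functional_boundary[OF gF l J(1) u bc h dg] by simp
      qed
      then show ?thesis unfolding Z_def using free_module_smult[OF yc h] by blast
    qed
    then have "fills k J' (\<lambda>s. y [^] c \<otimes> h s)" by (rule fillsJ'[OF k(1)])
    then obtain e v where e: "e \<in> F (Suc k)" and v: "v \<in> F k" "\<And>s. v s \<in> J'"
      and hev: "\<And>s. y [^] c \<otimes> h s = d k e s \<oplus> v s"
      unfolding fills_def by blast
    \<comment> \<open>Only \<open>y [^] c \<otimes> h s\<close> was filled, so the remaining factor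
      \<open>y [^] t\<close> of \<open>?b\<close> becomes the multiplier of the correction.\<close>
    have "d k g s = u s \<oplus> y [^] t \<otimes> (d k e s \<oplus> v s)" for s
      using dg[of s] hev[of s] coeff_closed[OF h] yc yt unfolding b by (simp add: m_assoc)
    moreover have "u s \<in> J'" "y [^] t \<otimes> v s \<in> J'" for s
      using u(2) J(2) v(2) J'(1) yt by (auto simp: ideal.I_l_closed)
    ultimately obtain g' where g': "g' \<in> Z (Suc k) J'" and gg': "\<And>s. g s = g' s \<oplus> y [^] t \<otimes> e s"
      using correct_by_multiple[where u = u, OF gF e yt J'(1) _ v(1)] by blast
    have "fills n I g'" using fillsI[OF k(2)] g' unfolding Suc by simp
    moreover have "y [^] t \<otimes> e s \<in> I" for s
      using t coeff_closed[OF e] Cons.prems(2) by (simp add: ideal.I_r_closed)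
    ultimately show ?thesis
      using fills_add[where g' = g', OF _ free_module_smult[OF yt e] _ Cons.prems(2) gg'] unfolding Suc by blast
  qed
  moreover have "ideal ?J R" using add_cgenideal(1)[OF J(1) bc] .
  moreover have "?J \<subseteq> I"
    using add_cgenideal_minimal[OF Cons.prems(2), of J ?b] J(2) J'(2)
      ideal_pow_mono[OF Cons.prems(2) y t, of "c + t"] by auto
  moreover have "\<forall>x\<in>set (y # xs). \<exists>k::nat. x [^] k \<in> ?J"
    using add_cgenideal(2,3)[OF J(1) bc] J(3) by (metis set_ConsD subsetD)
  ultimately show ?case by blast
qed

text \<open>The ideal \<open>J\<close> that \<open>fills_of_power_cycle\<close> produces for
  \<open>\<mm>\<close> contains powers of all parameters, so a cycle modulo \<open>\<mm>\<close> can
  be changed by coefficients in \<open>\<mm>\<close> into a cycle modulo \<open>J\<close>, and that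
  one is a boundary modulo \<open>\<mm>\<close>. The bound on \<open>r\<close> is the length
  condition in degree \<open>Suc n\<close>.\<close>

theorem rigidity:
  assumes dim: "krull_dim R = enat r" "r \<le> Suc (Suc n)"
    and fills: "\<And>g. g \<in> Z n \<mm> \<Longrightarrow> fills n \<mm> g"
    and g: "g \<in> Z (Suc n) \<mm>"
  shows "fills (Suc n) \<mm> g"
proof -
  obtain xs where xs: "length xs = r" "set xs \<subseteq> \<mm>"
    and primary: "\<And>J y. ideal J R \<Longrightarrow> (\<And>x. x \<in> set xs \<Longrightarrow> \<exists>k::nat. x [^] k \<in> J) \<Longrightarrow> y \<in> \<mm>
           \<Longrightarrow> \<exists>k::nat. y [^] k \<in> J"
    using exists_parameters_of_krull_dim[OF dim(1)] by metis
  have "\<exists>k::nat. x [^] k \<in> \<mm>" if "x \<in> set xs" for x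
    using that xs(2) max_carrier by (intro exI[of _ 1]) (auto simp: subset_iff)
  moreover have "set xs \<subseteq> carrier R" using xs(2) max_carrier by blast
  ultimately obtain J where J: "ideal J R" "J \<subseteq> \<mm>" "\<And>x. x \<in> set xs \<Longrightarrow> \<exists>k::nat. x [^] k \<in> J"
    and fillsJ: "\<And>g. g \<in> Z (Suc n) J \<Longrightarrow> fills (Suc n) \<mm> g"
    using fills_of_power_cycle[of xs \<mm>] ideal_max xs(1) dim(2) by auto
  have pow: "\<exists>k::nat. y [^] k \<in> J" if "y \<in> \<mm>" for y
    using primary[OF J(1,3) that] .
  obtain g' h where "g' \<in> Z (Suc n) J" "h \<in> F (Suc n)" "\<And>s. h s \<in> \<mm>" "\<And>s. g s = g' s \<oplus> h s"
    using lift_cycle_to_primary_ideal[OF fills J(1,2) pow g] by blast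
  then show ?thesis using fills_add[OF fillsJ _ _ ideal_max] by blast
qed

end

section \<open>Submodules, quotients and linear extension\<close>

lemma linear_map_kernel:
  assumes "module R M" "module R N" "linear_map R M N h"
  shows "submodule {x \<in> carrier M. h x = \<zero>\<^bsub>N\<^esub>} R M"
proof -
  interpret M: module R M by fact
  interpret N: module R N by fact
  note h = linear_mapD[OF assms(3)]
  show ?thesis
  proof (rule M.submoduleI)
    show "\<zero>\<^bsub>M\<^esub> \<in> {x \<in> carrier M. h x = \<zero>\<^bsub>N\<^esub>}"
      using linear_map_zero[OF assms] by simp
    fix x assume "x \<in> {x \<in> carrier M. h x = \<zero>\<^bsub>N\<^esub>}"
    moreover from this have "\<ominus>\<^bsub>M\<^esub> x = (\<ominus>\<^bsub>R\<^esub> \<one>\<^bsub>R\<^esub>) \<odot>\<^bsub>M\<^esub> x" by (simp add: M.smult_l_minus)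
    ultimately show "\<ominus>\<^bsub>M\<^esub> x \<in> {x \<in> carrier M. h x = \<zero>\<^bsub>N\<^esub>}" using h(3) by simp
  qed (auto simp: h(2,3))
qed

lemma linear_map_image:
  assumes "module R M" "module R N" "linear_map R M N h"
  shows "submodule (h ` carrier M) R N"
proof -
  interpret M: module R M by fact
  interpret N: module R N by fact
  note h = linear_mapD[OF assms(3)]
  show ?thesis
  proof (rule N.submoduleI)
    show "\<zero>\<^bsub>N\<^esub> \<in> h ` carrier M"
      using linear_map_zero[OF assms] M.zero_closed by (intro image_eqI[of _ _ "\<zero>\<^bsub>M\<^esub>"]) simp_all
    show "h ` carrier M \<subseteq> carrier N" using h(1) by auto
    show "\<ominus>\<^bsub>N\<^esub> y \<in> h ` carrier M" if y: "y \<in> h ` carrier M" for y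
    proof -
      obtain x where x: "x \<in> carrier M" "y = h x" using y by auto
      have "\<ominus>\<^bsub>N\<^esub> y = (\<ominus>\<^bsub>R\<^esub> \<one>\<^bsub>R\<^esub>) \<odot>\<^bsub>N\<^esub> h x" using x h(1) by (simp add: N.smult_l_minus)
      also have "\<dots> = h ((\<ominus>\<^bsub>R\<^esub> \<one>\<^bsub>R\<^esub>) \<odot>\<^bsub>M\<^esub> x)" using x h(3) by simp
      finally show ?thesis using x by auto
    qed
    show "y \<oplus>\<^bsub>N\<^esub> z \<in> h ` carrier M" if "y \<in> h ` carrier M" "z \<in> h ` carrier M" for y z
      using that by (auto simp: h(2)[symmetric])
    show "r \<odot>\<^bsub>N\<^esub> y \<in> h ` carrier M" if "r \<in> carrier R" "y \<in> h ` carrier M" for r y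
      using that by (auto simp: h(3)[symmetric])
  qed
qed

section \<open>Spans and linear extension from a basis\<close>

context module
begin

lemma submodule_span:
  assumes "X \<subseteq> carrier M"
  shows "submodule (span_module R M X) R M"
proof (rule submoduleI)
  show "span_module R M X \<subseteq> carrier M"
    unfolding span_module_def using carrier_is_submodule assms by blast
  show "\<zero>\<^bsub>M\<^esub> \<in> span_module R M X"
    unfolding span_module_def
  proof (intro InterI, elim CollectE conjE)
    fix U assume "submodule U R M"
    from subgroup.one_closed[OF submodule.axioms(1)[OF this]] show "\<zero>\<^bsub>M\<^esub> \<in> U" by simp
  qed
qed (auto simp: span_module_def dest: submoduleE(3,4,5))

lemma span_superset: "X \<subseteq> span_module R M X"
  unfolding span_module_def by blast

lemma span_minimal: "submodule U R M \<Longrightarrow> X \<subseteq> U \<Longrightarrow> span_module R M X \<subseteq> U"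
  unfolding span_module_def by blast

text \<open>The defining sum runs over the support, which varies with \<open>f\<close>. Additivity
  needs the sums over one common finite set.\<close>

lemma linear_ext_eq:
  assumes "\<And>s. s \<in> S \<Longrightarrow> g s \<in> carrier M" "f \<in> carrier (free_module R S)"
    and "finite A" "{s. f s \<noteq> \<zero>\<^bsub>R\<^esub>} \<subseteq> A" "A \<subseteq> S"
  shows "linear_ext R M g f = finsum M (\<lambda>s. f s \<odot>\<^bsub>M\<^esub> g s) A"
  unfolding linear_ext_def using assms
  by (intro M.add.finprod_mono_neutral_cong_left) (auto simp: R.free_module_closed subset_iff)

lemma linear_ext_linear:
  assumes g: "\<And>s. s \<in> S \<Longrightarrow> g s \<in> carrier M"
  shows "linear_map R (free_module R S) M (linear_ext R M g)"
proof (rule linear_mapI)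
  have supp: "finite {s. f s \<noteq> \<zero>\<^bsub>R\<^esub>}" "{s. f s \<noteq> \<zero>\<^bsub>R\<^esub>} \<subseteq> S" if "f \<in> carrier (free_module R S)" for f
    using that by (auto simp: free_module_simps(1))
  have closed: "(\<lambda>s. f s \<odot>\<^bsub>M\<^esub> g s) \<in> A \<rightarrow> carrier M"
    if "f \<in> carrier (free_module R S)" "A \<subseteq> S" for f A
    using that(2) by (auto intro!: smult_closed R.free_module_closed[OF that(1)] g)
  show "linear_ext R M g f \<in> carrier M" if f: "f \<in> carrier (free_module R S)" for f
    unfolding linear_ext_def by (rule M.finsum_closed[OF closed[OF f supp(2)[OF f]]])
  show "linear_ext R M g (f \<oplus>\<^bsub>free_module R S\<^esub> f') = linear_ext R M g f \<oplus>\<^bsub>M\<^esub> linear_ext R M g f'"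
    if f: "f \<in> carrier (free_module R S)" and f': "f' \<in> carrier (free_module R S)" for f f'
  proof -
    let ?A = "{s. f s \<noteq> \<zero>\<^bsub>R\<^esub>} \<union> {s. f' s \<noteq> \<zero>\<^bsub>R\<^esub>}"
    have A: "finite ?A" "?A \<subseteq> S" using supp f f' by auto
    have "{s. f s \<oplus>\<^bsub>R\<^esub> f' s \<noteq> \<zero>\<^bsub>R\<^esub>} \<subseteq> ?A" by auto
    then have "linear_ext R M g (f \<oplus>\<^bsub>free_module R S\<^esub> f')
        = finsum M (\<lambda>s. (f s \<oplus>\<^bsub>R\<^esub> f' s) \<odot>\<^bsub>M\<^esub> g s) ?A"
      using linear_ext_eq[where g = g, OF g _ A(1) _ A(2), of "\<lambda>s. f s \<oplus>\<^bsub>R\<^esub> f' s"]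
        R.free_module_add[OF f f'] by auto
    also have "\<dots> = finsum M (\<lambda>s. f s \<odot>\<^bsub>M\<^esub> g s \<oplus>\<^bsub>M\<^esub> f' s \<odot>\<^bsub>M\<^esub> g s) ?A"
      using A(2) g R.free_module_closed[OF f] R.free_module_closed[OF f']
      by (intro M.finsum_cong') (auto simp: smult_l_distr subset_iff)
    also have "\<dots> = finsum M (\<lambda>s. f s \<odot>\<^bsub>M\<^esub> g s) ?A \<oplus>\<^bsub>M\<^esub> finsum M (\<lambda>s. f' s \<odot>\<^bsub>M\<^esub> g s) ?A"
      by (rule M.finsum_addf[OF closed[OF f A(2)] closed[OF f' A(2)]])
    also have "\<dots> = linear_ext R M g f \<oplus>\<^bsub>M\<^esub> linear_ext R M g f'"
      using linear_ext_eq[where g = g, OF g f A(1) _ A(2)] linear_ext_eq[where g = g, OF g f' A(1) _ A(2)]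
      by simp
    finally show ?thesis .
  qed
  show "linear_ext R M g (r \<odot>\<^bsub>free_module R S\<^esub> f) = r \<odot>\<^bsub>M\<^esub> linear_ext R M g f"
    if r: "r \<in> carrier R" and f: "f \<in> carrier (free_module R S)" for r f
  proof -
    let ?A = "{s. f s \<noteq> \<zero>\<^bsub>R\<^esub>}"
    have "{s. r \<otimes>\<^bsub>R\<^esub> f s \<noteq> \<zero>\<^bsub>R\<^esub>} \<subseteq> ?A" using r by auto
    then have "linear_ext R M g (r \<odot>\<^bsub>free_module R S\<^esub> f) = finsum M (\<lambda>s. (r \<otimes>\<^bsub>R\<^esub> f s) \<odot>\<^bsub>M\<^esub> g s) ?A"
      using linear_ext_eq[where g = g, OF g _ supp(1)[OF f] _ supp(2)[OF f], of "\<lambda>s. r \<otimes>\<^bsub>R\<^esub> f s"]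
        R.free_module_smult[OF r f] r by auto
    also have "\<dots> = finsum M (\<lambda>s. r \<odot>\<^bsub>M\<^esub> (f s \<odot>\<^bsub>M\<^esub> g s)) ?A"
      using supp(2)[OF f] g r R.free_module_closed[OF f]
      by (intro M.finsum_cong') (auto simp: smult_assoc1 subset_iff)
    also have "\<dots> = r \<odot>\<^bsub>M\<^esub> linear_ext R M g f"
      unfolding linear_ext_def
      by (rule finsum_smult_ldistr[OF supp(1)[OF f] r closed[OF f supp(2)[OF f]], symmetric])
    finally show ?thesis .
  qed
qed

lemma linear_ext_basis_vec:
  assumes "g s \<in> carrier M"
  shows "linear_ext R M g (basis_vec R s) = g s"
proof -
  have "linear_ext R M g (basis_vec R s) = finsum M (\<lambda>t. basis_vec R s t \<odot>\<^bsub>M\<^esub> g t) {s}"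
    using assms by (intro linear_ext_eq[of "{s}"] R.basis_vec_closed) (auto simp: basis_vec_def)
  also have "\<dots> = g s"
    using assms by (simp add: basis_vec_def)
  finally show ?thesis .
qed

end

section \<open>Quotient modules\<close>

locale quotient = module +
  fixes U
  assumes submodule: "submodule U R M"
begin

sublocale abelian_subgroup U M
  using submodule submodule.axioms(1) M.abelian_group_axioms
  by (intro abelian_subgroupI3 additive_subgroup.intro)

lemma quot_simps:
  "carrier (quot_module M U) = a_rcosets\<^bsub>M\<^esub> U" "\<zero>\<^bsub>quot_module M U\<^esub> = U"
  by (simp_all add: quot_module_def)

lemma mem_coset: "y \<in> U +>\<^bsub>M\<^esub> x \<longleftrightarrow> (\<exists>u\<in>U. y = u \<oplus>\<^bsub>M\<^esub> x)"
  unfolding a_r_coset_def' by blast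

lemma coset_eq_iff:
  assumes "x \<in> carrier M" "y \<in> carrier M"
  shows "U +>\<^bsub>M\<^esub> x = U +>\<^bsub>M\<^esub> y \<longleftrightarrow> (\<exists>u\<in>U. x = u \<oplus>\<^bsub>M\<^esub> y)"
proof
  assume "U +>\<^bsub>M\<^esub> x = U +>\<^bsub>M\<^esub> y"
  then have "x \<in> U +>\<^bsub>M\<^esub> y" by (intro a_repr_independenceD[OF assms(1)]) simp
  then show "\<exists>u\<in>U. x = u \<oplus>\<^bsub>M\<^esub> y" unfolding mem_coset .
next
  assume "\<exists>u\<in>U. x = u \<oplus>\<^bsub>M\<^esub> y"
  then have "x \<in> U +>\<^bsub>M\<^esub> y" unfolding mem_coset .
  from a_repr_independence'[OF this assms(2)] show "U +>\<^bsub>M\<^esub> x = U +>\<^bsub>M\<^esub> y" by simp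
qed

lemma coset_zero_iff:
  assumes "x \<in> carrier M"
  shows "U +>\<^bsub>M\<^esub> x = U \<longleftrightarrow> x \<in> U"
  using a_rcos_const[of x] a_rcos_self[OF assms] by auto

lemma coset_closed: "x \<in> carrier M \<Longrightarrow> U +>\<^bsub>M\<^esub> x \<in> carrier (quot_module M U)"
  unfolding quot_simps by (rule M.a_rcosetsI[OF a_subset])

lemma quot_carrierE:
  assumes "X \<in> carrier (quot_module M U)"
  obtains x where "x \<in> carrier M" "X = U +>\<^bsub>M\<^esub> x"
  using assms unfolding quot_simps A_RCOSETS_def' by blast

lemma quot_add:
  assumes "x \<in> carrier M" "y \<in> carrier M"
  shows "(U +>\<^bsub>M\<^esub> x) \<oplus>\<^bsub>quot_module M U\<^esub> (U +>\<^bsub>M\<^esub> y) = U +>\<^bsub>M\<^esub> (x \<oplus>\<^bsub>M\<^esub> y)"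
  using a_rcos_sum assms unfolding quot_module_def by simp

text \<open>The union in the definition ranges over the representatives of one coset; all its
  members agree, because \<open>U\<close> is closed under multiplication by
  \<open>r\<close>.\<close>

lemma quot_smult:
  assumes r: "r \<in> carrier R" and x: "x \<in> carrier M"
  shows "r \<odot>\<^bsub>quot_module M U\<^esub> (U +>\<^bsub>M\<^esub> x) = U +>\<^bsub>M\<^esub> (r \<odot>\<^bsub>M\<^esub> x)"
proof -
  have "U +>\<^bsub>M\<^esub> (r \<odot>\<^bsub>M\<^esub> y) = U +>\<^bsub>M\<^esub> (r \<odot>\<^bsub>M\<^esub> x)" if y: "y \<in> U +>\<^bsub>M\<^esub> x" for y
  proof -
    obtain u where u: "u \<in> U" "y = u \<oplus>\<^bsub>M\<^esub> x" using y unfolding mem_coset by (rule bexE)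
    have uc: "u \<in> carrier M" using u a_subset by blast
    have "r \<odot>\<^bsub>M\<^esub> y = r \<odot>\<^bsub>M\<^esub> u \<oplus>\<^bsub>M\<^esub> r \<odot>\<^bsub>M\<^esub> x" using u uc r x by (simp add: smult_r_distr)
    moreover have "r \<odot>\<^bsub>M\<^esub> u \<in> U" using submoduleE(4)[OF submodule r u(1)] .
    ultimately show ?thesis using coset_eq_iff u(2) uc r x by auto
  qed
  moreover have "U +>\<^bsub>M\<^esub> x \<noteq> {}" using a_rcos_self[OF x] by auto
  ultimately have "(\<Union>y\<in>U +>\<^bsub>M\<^esub> x. U +>\<^bsub>M\<^esub> (r \<odot>\<^bsub>M\<^esub> y)) = U +>\<^bsub>M\<^esub> (r \<odot>\<^bsub>M\<^esub> x)"
    by (intro SUP_eq_const)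
  then show ?thesis unfolding quot_module_def by simp
qed

lemma module_quot: "module R (quot_module M U)"
proof (rule moduleI[OF R.is_cring])
  show "abelian_group (quot_module M U)"
  proof (rule abelian_groupI)
    show "\<zero>\<^bsub>quot_module M U\<^esub> \<in> carrier (quot_module M U)"
      unfolding quot_simps by (rule a_subgroup_in_rcosets)
    fix X assume "X \<in> carrier (quot_module M U)"
    then obtain x where x: "x \<in> carrier M" "X = U +>\<^bsub>M\<^esub> x" by (rule quot_carrierE)
    have zero: "U = U +>\<^bsub>M\<^esub> \<zero>\<^bsub>M\<^esub>" using a_rcos_const[OF zero_closed] by simp
    show "\<zero>\<^bsub>quot_module M U\<^esub> \<oplus>\<^bsub>quot_module M U\<^esub> X = X"
      unfolding quot_simps using quot_add[of "\<zero>\<^bsub>M\<^esub>" x] zero x by simp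
    show "\<exists>Y\<in>carrier (quot_module M U). Y \<oplus>\<^bsub>quot_module M U\<^esub> X = \<zero>\<^bsub>quot_module M U\<^esub>"
      unfolding quot_simps(2) using quot_add[of "\<ominus>\<^bsub>M\<^esub> x" x] zero x
      by (intro bexI[of _ "U +>\<^bsub>M\<^esub> (\<ominus>\<^bsub>M\<^esub> x)"]) (simp_all add: coset_closed M.l_neg)
  qed (auto elim!: quot_carrierE simp: quot_add coset_closed M.a_ac)
qed (auto elim!: quot_carrierE simp: quot_smult quot_add coset_closed smult_l_distr smult_r_distr
      smult_assoc1)

lemma coset_linear: "linear_map R M (quot_module M U) (\<lambda>x. U +>\<^bsub>M\<^esub> x)"
  by (rule linear_mapI) (simp_all add: coset_closed quot_add quot_smult)

end

text \<open>Cosets of \<open>B\<close> depend only on the addition, so shrinking the carrier to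
  \<open>C\<close> merely selects the cosets of elements of \<open>C\<close>. This is the shape in
  which \<open>Tor\<close> divides cycles by boundaries.\<close>

lemma (in module) zero_quotient_iff:
  assumes B: "submodule B R M" and C: "C \<subseteq> carrier M" "C \<noteq> {}"
  shows "is_zero_module (quot_module (M\<lparr>carrier := C\<rparr>) B) \<longleftrightarrow> C \<subseteq> B"
proof -
  interpret quotient R M B by (intro quotient.intro quotient_axioms.intro B module_axioms)
  have "carrier (quot_module (M\<lparr>carrier := C\<rparr>) B) = (\<lambda>x. B +>\<^bsub>M\<^esub> x) ` C"
    by (auto simp: quot_module_def A_RCOSETS_def' a_r_coset_def')
  moreover have "\<zero>\<^bsub>quot_module (M\<lparr>carrier := C\<rparr>) B\<^esub> = B"
    by (simp add: quot_module_def)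
  ultimately have "is_zero_module (quot_module (M\<lparr>carrier := C\<rparr>) B) \<longleftrightarrow> (\<lambda>x. B +>\<^bsub>M\<^esub> x) ` C = {B}"
    unfolding is_zero_module_def by simp
  also have "\<dots> \<longleftrightarrow> (\<forall>x\<in>C. B +>\<^bsub>M\<^esub> x = B)" using C(2) by auto
  also have "\<dots> \<longleftrightarrow> (\<forall>x\<in>C. x \<in> B)" using coset_zero_iff C(1) by (intro ball_cong) auto
  finally show ?thesis by auto
qed

section \<open>Tensor products\<close>

definition bilinear_map where
  "bilinear_map R M N Q b \<longleftrightarrow>
     (\<forall>x\<in>carrier M. linear_map R N Q (b x)) \<and>
     (\<forall>y\<in>carrier N. linear_map R M Q (\<lambda>x. b x y))"

lemma bilinear_mapD:
  assumes "bilinear_map R M N Q b"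
  shows "x \<in> carrier M \<Longrightarrow> linear_map R N Q (b x)"
    and "y \<in> carrier N \<Longrightarrow> linear_map R M Q (\<lambda>x. b x y)"
  using assms unfolding bilinear_map_def by blast+

locale module_pair = M: module R M + N: module R N
  for R :: "('a, 'm) ring_scheme" (structure)
    and M :: "('a, 'b, 'n) module_scheme" and N :: "('a, 'c, 'p) module_scheme"
begin

abbreviation "G \<equiv> free_module R (carrier M \<times> carrier N)"

lemma basis_vec_pair: "x \<in> carrier M \<Longrightarrow> y \<in> carrier N \<Longrightarrow> basis_vec R (x, y) \<in> carrier G"
  by (rule M.R.basis_vec_closed) simp

sublocale G: module R G
  by (rule M.R.module_free)

lemma tensor_relsE:
  assumes "z \<in> tensor_rels R M N"
  obtains (add_left) x x' y where "x \<in> carrier M" "x' \<in> carrier M" "y \<in> carrier N"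
      "z = basis_vec R (x \<oplus>\<^bsub>M\<^esub> x', y) \<ominus>\<^bsub>G\<^esub> (basis_vec R (x, y) \<oplus>\<^bsub>G\<^esub> basis_vec R (x', y))"
  | (add_right) x y y' where "x \<in> carrier M" "y \<in> carrier N" "y' \<in> carrier N"
      "z = basis_vec R (x, y \<oplus>\<^bsub>N\<^esub> y') \<ominus>\<^bsub>G\<^esub> (basis_vec R (x, y) \<oplus>\<^bsub>G\<^esub> basis_vec R (x, y'))"
  | (smult_left) r x y where "r \<in> carrier R" "x \<in> carrier M" "y \<in> carrier N"
      "z = basis_vec R (r \<odot>\<^bsub>M\<^esub> x, y) \<ominus>\<^bsub>G\<^esub> (r \<odot>\<^bsub>G\<^esub> basis_vec R (x, y))"
  | (smult_right) r x y where "r \<in> carrier R" "x \<in> carrier M" "y \<in> carrier N"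
      "z = basis_vec R (x, r \<odot>\<^bsub>N\<^esub> y) \<ominus>\<^bsub>G\<^esub> (r \<odot>\<^bsub>G\<^esub> basis_vec R (x, y))"
  using assms[unfolded tensor_rels_def Let_def]
  by (elim UnE CollectE exE conjE) (rule add_left add_right smult_left smult_right; assumption)+

lemma tensor_rels_closed: "tensor_rels R M N \<subseteq> carrier G"
proof
  fix z assume "z \<in> tensor_rels R M N"
  then show "z \<in> carrier G"
    by (cases rule: tensor_relsE) (auto simp del: free_module_simps intro!: G.M.minus_closed
        G.M.a_closed G.smult_closed basis_vec_pair M.smult_closed N.smult_closed)
qed

sublocale T: quotient R G "tensor_ker R M N"
  unfolding tensor_ker_def
  by (intro quotient.intro quotient_axioms.intro G.module_axioms G.submodule_span tensor_rels_closed)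

lemma module_tensor: "module R (tensor_module R M N)"
  unfolding tensor_module_def by (rule T.module_quot)

lemma tensor_zero: "\<zero>\<^bsub>tensor_module R M N\<^esub> = tensor_ker R M N"
  unfolding tensor_module_def by (rule T.quot_simps)

lemma pure_tensor_closed:
  "x \<in> carrier M \<Longrightarrow> y \<in> carrier N \<Longrightarrow> pure_tensor R M N x y \<in> carrier (tensor_module R M N)"
  unfolding tensor_module_def pure_tensor_def by (intro T.coset_closed basis_vec_pair)

lemma coset_eq_of_rel:
  assumes "x \<in> carrier G" "y \<in> carrier G" "x \<ominus>\<^bsub>G\<^esub> y \<in> tensor_rels R M N"
  shows "tensor_ker R M N +>\<^bsub>G\<^esub> x = tensor_ker R M N +>\<^bsub>G\<^esub> y"
proof -
  have "x \<ominus>\<^bsub>G\<^esub> y \<in> tensor_ker R M N"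
    unfolding tensor_ker_def using assms(3) G.span_superset by blast
  moreover have "x = (x \<ominus>\<^bsub>G\<^esub> y) \<oplus>\<^bsub>G\<^esub> y"
    using assms(1,2) unfolding G.M.minus_eq
    by (simp add: G.M.a_assoc G.M.l_neg del: free_module_simps)
  ultimately show ?thesis using T.coset_eq_iff[OF assms(1,2)] by blast
qed

lemma pure_tensor_bilinear: "bilinear_map R M N (tensor_module R M N) (pure_tensor R M N)"
  unfolding bilinear_map_def
proof (intro conjI ballI linear_mapI)
  note rels = tensor_rels_def Let_def
  note closed = basis_vec_pair M.M.a_closed N.M.a_closed M.smult_closed N.smult_closed
    G.M.a_closed G.smult_closed
  fix x assume x: "x \<in> carrier M"
  show "pure_tensor R M N x (y \<oplus>\<^bsub>N\<^esub> y')
      = pure_tensor R M N x y \<oplus>\<^bsub>tensor_module R M N\<^esub> pure_tensor R M N x y'"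
    if "y \<in> carrier N" "y' \<in> carrier N" for y y'
  proof -
    have "basis_vec R (x, y \<oplus>\<^bsub>N\<^esub> y') \<ominus>\<^bsub>G\<^esub> (basis_vec R (x, y) \<oplus>\<^bsub>G\<^esub> basis_vec R (x, y'))
        \<in> tensor_rels R M N"
      unfolding rels using x that by blast
    from coset_eq_of_rel[OF _ _ this] show ?thesis
      unfolding pure_tensor_def tensor_module_def
      using x that by (simp add: T.quot_add closed del: free_module_simps)
  qed
  show "pure_tensor R M N x (r \<odot>\<^bsub>N\<^esub> y) = r \<odot>\<^bsub>tensor_module R M N\<^esub> pure_tensor R M N x y"
    if "r \<in> carrier R" "y \<in> carrier N" for r y
  proof -
    have "basis_vec R (x, r \<odot>\<^bsub>N\<^esub> y) \<ominus>\<^bsub>G\<^esub> (r \<odot>\<^bsub>G\<^esub> basis_vec R (x, y)) \<in> tensor_rels R M N"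
      unfolding rels using x that by blast
    from coset_eq_of_rel[OF _ _ this] show ?thesis
      unfolding pure_tensor_def tensor_module_def
      using x that by (simp add: T.quot_smult closed del: free_module_simps)
  qed
next
  note rels = tensor_rels_def Let_def
  note closed = basis_vec_pair M.M.a_closed N.M.a_closed M.smult_closed N.smult_closed
    G.M.a_closed G.smult_closed
  fix y assume y: "y \<in> carrier N"
  show "pure_tensor R M N (x \<oplus>\<^bsub>M\<^esub> x') y
      = pure_tensor R M N x y \<oplus>\<^bsub>tensor_module R M N\<^esub> pure_tensor R M N x' y"
    if "x \<in> carrier M" "x' \<in> carrier M" for x x'
  proof -
    have "basis_vec R (x \<oplus>\<^bsub>M\<^esub> x', y) \<ominus>\<^bsub>G\<^esub> (basis_vec R (x, y) \<oplus>\<^bsub>G\<^esub> basis_vec R (x', y))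
        \<in> tensor_rels R M N"
      unfolding rels using y that by blast
    from coset_eq_of_rel[OF _ _ this] show ?thesis
      unfolding pure_tensor_def tensor_module_def
      using y that by (simp add: T.quot_add closed del: free_module_simps)
  qed
  show "pure_tensor R M N (r \<odot>\<^bsub>M\<^esub> x) y = r \<odot>\<^bsub>tensor_module R M N\<^esub> pure_tensor R M N x y"
    if "r \<in> carrier R" "x \<in> carrier M" for r x
  proof -
    have "basis_vec R (r \<odot>\<^bsub>M\<^esub> x, y) \<ominus>\<^bsub>G\<^esub> (r \<odot>\<^bsub>G\<^esub> basis_vec R (x, y)) \<in> tensor_rels R M N"
      unfolding rels using y that by blast
    from coset_eq_of_rel[OF _ _ this] show ?thesis
      unfolding pure_tensor_def tensor_module_def
      using y that by (simp add: T.quot_smult closed del: free_module_simps)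
  qed
qed (simp_all add: pure_tensor_closed)

text \<open>The universal property: the kernel of the linear extension of \<open>b\<close> is a
  submodule containing the bilinearity relations, hence their span.\<close>

lemma tensor_ker_null:
  assumes Q: "module R Q" and b: "bilinear_map R M N Q b" and u: "u \<in> tensor_ker R M N"
  shows "linear_ext R Q (\<lambda>(x, y). b x y) u = \<zero>\<^bsub>Q\<^esub>"
proof -
  interpret Q: module R Q by fact
  let ?b = "\<lambda>(x, y). b x y"
  have bc: "b x y \<in> carrier Q" if "x \<in> carrier M" "y \<in> carrier N" for x y
    using linear_mapD(1)[OF bilinear_mapD(1)[OF b that(1)] that(2)] .
  have lin: "linear_map R G Q (linear_ext R Q ?b)"
    by (rule Q.linear_ext_linear) (auto simp: bc)
  have ev: "linear_ext R Q ?b (basis_vec R (x, y)) = b x y" if "x \<in> carrier M" "y \<in> carrier N" for x y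
    using Q.linear_ext_basis_vec[of ?b "(x, y)"] bc[OF that] by simp
  have diff: "linear_ext R Q ?b (p \<ominus>\<^bsub>G\<^esub> q) = \<zero>\<^bsub>Q\<^esub>"
    if "p \<in> carrier G" "q \<in> carrier G" "linear_ext R Q ?b p = linear_ext R Q ?b q" for p q
  proof -
    have "p \<ominus>\<^bsub>G\<^esub> q = p \<oplus>\<^bsub>G\<^esub> (\<ominus> \<one>) \<odot>\<^bsub>G\<^esub> q"
      unfolding G.M.minus_eq using that by (simp add: G.smult_l_minus del: free_module_simps)
    moreover have "(\<ominus> \<one>) \<odot>\<^bsub>G\<^esub> q \<in> carrier G" by (rule G.smult_closed[OF _ that(2)]) simp
    ultimately have "linear_ext R Q ?b (p \<ominus>\<^bsub>G\<^esub> q)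
        = linear_ext R Q ?b p \<oplus>\<^bsub>Q\<^esub> (\<ominus> \<one>) \<odot>\<^bsub>Q\<^esub> linear_ext R Q ?b q"
      using linear_mapD(2)[OF lin that(1)] linear_mapD(3)[OF lin _ that(2), of "\<ominus> \<one>"] by simp
    then show ?thesis
      using linear_mapD(1)[OF lin that(2)] that(3) by (simp add: Q.smult_l_minus Q.M.r_neg)
  qed
  note closed = basis_vec_pair M.M.a_closed N.M.a_closed M.smult_closed N.smult_closed
    G.M.a_closed G.smult_closed
  note lin1 = linear_mapD(2,3)[OF bilinear_mapD(1)[OF b]] and lin2 = linear_mapD(2,3)[OF bilinear_mapD(2)[OF b]]
  have "linear_ext R Q ?b z = \<zero>\<^bsub>Q\<^esub>" if "z \<in> tensor_rels R M N" for z
    using that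
  proof (cases rule: tensor_relsE)
    case (add_left x x' y)
    then show ?thesis by (auto simp del: free_module_simps simp: closed ev lin1 lin2 linear_mapD(2)[OF lin] intro!: diff)
  next
    case (add_right x y y')
    then show ?thesis by (auto simp del: free_module_simps simp: closed ev lin1 lin2 linear_mapD(2)[OF lin] intro!: diff)
  next
    case (smult_left r x y)
    then show ?thesis by (auto simp del: free_module_simps simp: closed ev lin1 lin2 linear_mapD(3)[OF lin] intro!: diff)
  next
    case (smult_right r x y)
    then show ?thesis by (auto simp del: free_module_simps simp: closed ev lin1 lin2 linear_mapD(3)[OF lin] intro!: diff)
  qed
  then have "tensor_rels R M N \<subseteq> {p \<in> carrier G. linear_ext R Q ?b p = \<zero>\<^bsub>Q\<^esub>}"
    using tensor_rels_closed by blast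
  then have "tensor_ker R M N \<subseteq> {p \<in> carrier G. linear_ext R Q ?b p = \<zero>\<^bsub>Q\<^esub>}"
    unfolding tensor_ker_def
    by (rule G.span_minimal[OF linear_map_kernel[OF M.R.module_free Q lin]])
  then show ?thesis using u by blast
qed

text \<open>Stated for the image of a whole coset, since \<open>tensor_map\<close> applies
  \<open>the_elem\<close> to such an image.\<close>

lemma linear_ext_pure_tensor:
  assumes Q: "module R Q" and b: "bilinear_map R M N Q b" and x: "x \<in> carrier M" and y: "y \<in> carrier N"
  shows "linear_ext R Q (\<lambda>(x, y). b x y) ` pure_tensor R M N x y = {b x y}"
proof -
  interpret Q: module R Q by fact
  let ?b = "\<lambda>(x, y). b x y"
  have bc: "b x y \<in> carrier Q" if "x \<in> carrier M" "y \<in> carrier N" for x y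
    using linear_mapD(1)[OF bilinear_mapD(1)[OF b that(1)] that(2)] .
  have lin: "linear_map R G Q (linear_ext R Q ?b)"
    by (rule Q.linear_ext_linear) (auto simp: bc)
  have ev: "linear_ext R Q ?b (basis_vec R (x, y)) = b x y"
    using Q.linear_ext_basis_vec[of ?b "(x, y)"] bc[OF x y] by simp
  have "linear_ext R Q ?b p = b x y" if p: "p \<in> pure_tensor R M N x y" for p
  proof -
    obtain u where u: "u \<in> tensor_ker R M N" "p = u \<oplus>\<^bsub>G\<^esub> basis_vec R (x, y)"
      using p unfolding pure_tensor_def T.mem_coset by (rule bexE)
    then show ?thesis
      using linear_mapD(2)[OF lin, of u "basis_vec R (x, y)"] T.a_subset basis_vec_pair[OF x y]
        tensor_ker_null[OF Q b u(1)] ev bc[OF x y] by auto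
  qed
  moreover have "basis_vec R (x, y) \<in> pure_tensor R M N x y"
    unfolding pure_tensor_def by (rule T.a_rcos_self[OF basis_vec_pair[OF x y]])
  ultimately show ?thesis by force
qed

end

lemma tensor_map_pure:
  assumes "module R M" "module R M'" "module R N" and h: "linear_map R M M' h"
    and x: "x \<in> carrier M" and y: "y \<in> carrier N"
  shows "tensor_map R M' N h (pure_tensor R M N x y) = pure_tensor R M' N (h x) y"
proof -
  interpret MN: module_pair R M N by (intro module_pair.intro assms)
  interpret M'N: module_pair R M' N by (intro module_pair.intro assms)
  let ?T = "tensor_module R M' N"
  have "bilinear_map R M N ?T (\<lambda>x y. pure_tensor R M' N (h x) y)"
    unfolding bilinear_map_def
    using linear_mapD[OF h] linear_mapD[OF bilinear_mapD(1)[OF M'N.pure_tensor_bilinear]]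
      linear_mapD[OF bilinear_mapD(2)[OF M'N.pure_tensor_bilinear]]
    by (auto intro!: linear_mapI)
  from MN.linear_ext_pure_tensor[OF M'N.module_tensor this x y]
  show ?thesis unfolding tensor_map_def by simp
qed

section \<open>Tensor products with the residue field\<close>

context noetherian_local_cring
begin

abbreviation "unit \<equiv> \<mm> +>\<^bsub>self_module R\<^esub> \<one>"

lemma submodule_max: "submodule \<mm> R (self_module R)"
proof -
  interpret S: module R "self_module R" by (rule module_self)
  interpret \<mm>: ideal \<mm> R by (rule ideal_max)
  show ?thesis
  proof (rule S.submoduleI)
    fix a assume a: "a \<in> \<mm>"
    have "\<ominus>\<^bsub>self_module R\<^esub> a = (\<ominus> \<one>) \<odot>\<^bsub>self_module R\<^esub> a"
      using a max_carrier S.smult_l_minus[of \<one> a] S.smult_one[of a] by auto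
    then show "\<ominus>\<^bsub>self_module R\<^esub> a \<in> \<mm>" using a by (simp add: \<mm>.I_l_closed)
  qed (use max_carrier \<mm>.I_l_closed in auto)
qed

sublocale residue: quotient R "self_module R" \<mm>
  by (intro quotient.intro quotient_axioms.intro module_self submodule_max)

lemma module_residue: "module R (residue_field R \<mm>)"
  unfolding residue_field_def by (rule residue.module_quot)

lemma unit_closed: "unit \<in> carrier (residue_field R \<mm>)"
  unfolding residue_field_def by (rule residue.coset_closed) simp

lemma smult_unit:
  assumes "r \<in> carrier R"
  shows "r \<odot>\<^bsub>residue_field R \<mm>\<^esub> unit = \<mm> +>\<^bsub>self_module R\<^esub> r"
  unfolding residue_field_def using residue.quot_smult[OF assms, of \<one>] assms by simp

lemma smult_unit_zero_iff:
  assumes "r \<in> carrier R"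
  shows "r \<odot>\<^bsub>residue_field R \<mm>\<^esub> unit = \<zero>\<^bsub>residue_field R \<mm>\<^esub> \<longleftrightarrow> r \<in> \<mm>"
  unfolding smult_unit[OF assms] using residue.coset_zero_iff[of r] assms
  by (simp add: residue_field_def residue.quot_simps)

lemma residue_cyclic:
  assumes "y \<in> carrier (residue_field R \<mm>)"
  obtains r where "r \<in> carrier R" "y = r \<odot>\<^bsub>residue_field R \<mm>\<^esub> unit"
proof -
  obtain r where "r \<in> carrier (self_module R)" "y = \<mm> +>\<^bsub>self_module R\<^esub> r"
    using assms unfolding residue_field_def by (rule residue.quot_carrierE)
  then show thesis using that smult_unit by simp
qed

lemma pure_unit_linear:
  assumes "module R N"
  shows "linear_map R N (tensor_module R N (residue_field R \<mm>)) (\<lambda>x. pure_tensor R N (residue_field R \<mm>) x unit)"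
proof -
  interpret module_pair R N "residue_field R \<mm>" by (intro module_pair.intro assms module_residue)
  show ?thesis using bilinear_mapD(2)[OF pure_tensor_bilinear unit_closed] .
qed

text \<open>The residue field is generated by \<open>unit\<close>, so scalars can be moved to the
  left factor and sums collected there. Hence knowing \<open>tensor_map\<close> on pure tensors is
  enough.\<close>

lemma tensor_residue_pure:
  assumes N: "module R N" and X: "X \<in> carrier (tensor_module R N (residue_field R \<mm>))"
  shows "\<exists>x\<in>carrier N. X = pure_tensor R N (residue_field R \<mm>) x unit"
proof -
  let ?k = "residue_field R \<mm>"
  interpret module_pair R N ?k by (intro module_pair.intro N module_residue)
  let ?p = "\<lambda>x. pure_tensor R N ?k x unit"
  note p = linear_mapD[OF pure_unit_linear[OF N]]
  obtain f where f: "f \<in> carrier G" "X = tensor_ker R N ?k +>\<^bsub>G\<^esub> f"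
    using X unfolding tensor_module_def by (rule T.quot_carrierE)
  have "\<exists>x\<in>carrier N. tensor_ker R N ?k +>\<^bsub>G\<^esub> f = ?p x"
    using f(1)
  proof (induction f rule: free_module_induct)
    case zero
    have "tensor_ker R N ?k +>\<^bsub>G\<^esub> (\<lambda>_. \<zero>) = \<zero>\<^bsub>tensor_module R N ?k\<^esub>"
      unfolding tensor_zero using T.a_rcos_const[OF T.zero_closed] by simp
    then show ?case
      using linear_map_zero[OF N module_tensor pure_unit_linear[OF N]] M.M.zero_closed by metis
  next
    case (add f s r)
    obtain x where x: "x \<in> carrier N" "tensor_ker R N ?k +>\<^bsub>G\<^esub> f = ?p x" using add.IH by blast
    obtain x' y where s: "s = (x', y)" "x' \<in> carrier N" "y \<in> carrier ?k" using add.hyps(2) by auto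
    obtain q where q: "q \<in> carrier R" "y = q \<odot>\<^bsub>?k\<^esub> unit" using s(3) by (rule residue_cyclic)
    have b: "basis_vec R s \<in> carrier G" unfolding s(1) using s by (intro basis_vec_pair)
    have "tensor_ker R N ?k +>\<^bsub>G\<^esub> basis_vec R s = pure_tensor R N ?k x' y"
      unfolding s(1) pure_tensor_def ..
    also have "\<dots> = q \<odot>\<^bsub>tensor_module R N ?k\<^esub> ?p x'"
      unfolding q(2) using linear_mapD(3)[OF bilinear_mapD(1)[OF pure_tensor_bilinear s(2)] q(1) unit_closed] .
    also have "\<dots> = ?p (q \<odot>\<^bsub>N\<^esub> x')" using p(3) q(1) s(2) by simp
    finally have *: "tensor_ker R N ?k +>\<^bsub>G\<^esub> basis_vec R s = ?p (q \<odot>\<^bsub>N\<^esub> x')" .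
    have qx: "q \<odot>\<^bsub>N\<^esub> x' \<in> carrier N" using q s by simp
    have "tensor_ker R N ?k +>\<^bsub>G\<^esub> (f \<oplus>\<^bsub>G\<^esub> (r \<odot>\<^bsub>G\<^esub> basis_vec R s))
        = ?p x \<oplus>\<^bsub>tensor_module R N ?k\<^esub> r \<odot>\<^bsub>tensor_module R N ?k\<^esub> ?p (q \<odot>\<^bsub>N\<^esub> x')"
      using linear_mapD(2)[OF T.coset_linear add.hyps(1) G.smult_closed[OF add.hyps(4) b]]
        linear_mapD(3)[OF T.coset_linear add.hyps(4) b] x(2) *
      unfolding tensor_module_def by simp
    also have "\<dots> = ?p (x \<oplus>\<^bsub>N\<^esub> r \<odot>\<^bsub>N\<^esub> (q \<odot>\<^bsub>N\<^esub> x'))"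
      using p(2)[OF x(1) M.smult_closed[OF add.hyps(4) qx]] p(3)[OF add.hyps(4) qx] by simp
    finally show ?case
      using x(1) M.smult_closed[OF add.hyps(4) qx] by (intro bexI[of _ "x \<oplus>\<^bsub>N\<^esub> r \<odot>\<^bsub>N\<^esub> (q \<odot>\<^bsub>N\<^esub> x')"]) auto
  qed
  then show ?thesis using f(2) by simp
qed

text \<open>This is the identification of \<open>F \<otimes> k\<close> with \<open>F/\<mm>F\<close>
  for free \<open>F\<close>. Each coordinate gives a bilinear map to \<open>k\<close> that detects
  coefficients outside \<open>\<mm>\<close>; conversely a coefficient in \<open>\<mm>\<close> can be
  moved to the right factor, where it kills \<open>unit\<close>.\<close>

lemma pure_unit_zero_iff:
  fixes S :: "'s set"
  assumes f: "f \<in> carrier (free_module R S)"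
  shows "pure_tensor R (free_module R S) (residue_field R \<mm>) f unit
           = \<zero>\<^bsub>tensor_module R (free_module R S) (residue_field R \<mm>)\<^esub> \<longleftrightarrow> (\<forall>s. f s \<in> \<mm>)"
proof -
  let ?k = "residue_field R \<mm>" and ?F = "free_module R S"
  interpret module_pair R ?F ?k by (intro module_pair.intro module_free module_residue)
  interpret T: module R "tensor_module R ?F ?k" by (rule module_tensor)
  let ?p = "\<lambda>x. pure_tensor R ?F ?k x unit" and ?z = "\<zero>\<^bsub>tensor_module R ?F ?k\<^esub>"
  note p = linear_mapD[OF pure_unit_linear[OF module_free]]
  show ?thesis
  proof
    assume zero: "?p f = ?z"
    show "\<forall>s. f s \<in> \<mm>"
    proof
      fix s :: 's
      let ?b = "\<lambda>x y. x s \<odot>\<^bsub>?k\<^esub> y"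
      have bil: "bilinear_map R ?F ?k ?k ?b"
        unfolding bilinear_map_def
        by (auto intro!: linear_mapI simp: free_module_closed N.smult_l_distr N.smult_r_distr
            N.smult_assoc1[symmetric] m_comm)
      have "linear_ext R ?k (\<lambda>(x, y). ?b x y) ` ?p f = linear_ext R ?k (\<lambda>(x, y). ?b x y) ` ?p (\<lambda>_. \<zero>)"
        using zero linear_map_zero[OF module_free module_tensor pure_unit_linear[OF module_free]] by simp
      moreover have "(\<lambda>_. \<zero>) \<in> carrier ?F" using M.M.zero_closed by simp
      ultimately have "?b f unit = ?b (\<lambda>_. \<zero>) unit"
        using linear_ext_pure_tensor[OF module_residue bil f unit_closed]
          linear_ext_pure_tensor[OF module_residue bil _ unit_closed, of "\<lambda>_. \<zero>"] by simp
      then have "f s \<odot>\<^bsub>?k\<^esub> unit = \<zero>\<^bsub>?k\<^esub>" using unit_closed by simp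
      then show "f s \<in> \<mm>" using smult_unit_zero_iff free_module_closed[OF f] by simp
    qed
  next
    assume vals: "\<forall>s. f s \<in> \<mm>"
    have "(\<forall>s. f s \<in> \<mm>) \<longrightarrow> ?p f = ?z"
      using f
    proof (induction f rule: free_module_induct)
      case zero
      then show ?case using linear_map_zero[OF module_free module_tensor pure_unit_linear[OF module_free]] by simp
    next
      case (add f s r)
      have b: "basis_vec R s \<in> carrier ?F" by (rule basis_vec_closed[OF add.hyps(2)])
      show ?case
      proof
        assume vals: "\<forall>t. (f \<oplus>\<^bsub>?F\<^esub> (r \<odot>\<^bsub>?F\<^esub> basis_vec R s)) t \<in> \<mm>"
        have r: "r \<in> \<mm>" using vals[rule_format, of s] add.hyps by (simp add: basis_vec_def)
        have "f t \<in> \<mm>" for t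
          using vals[rule_format, of t] add.hyps free_module_closed[OF add.hyps(1), of t]
            additive_subgroup.zero_closed[OF ideal.axioms(1)[OF ideal_max]]
          by (cases "t = s") (auto simp: basis_vec_def)
        then have "?p f = ?z" using add.IH by blast
        moreover have "r \<odot>\<^bsub>tensor_module R ?F ?k\<^esub> ?p (basis_vec R s) = ?z"
        proof -
          note lin = bilinear_mapD(1)[OF pure_tensor_bilinear b]
          have "r \<odot>\<^bsub>tensor_module R ?F ?k\<^esub> ?p (basis_vec R s)
              = pure_tensor R ?F ?k (basis_vec R s) (r \<odot>\<^bsub>?k\<^esub> unit)"
            using linear_mapD(3)[OF lin add.hyps(4) unit_closed] by simp
          also have "\<dots> = ?z"
            using smult_unit_zero_iff[OF add.hyps(4)] r linear_map_zero[OF module_residue module_tensor lin] by simp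
          finally show ?thesis .
        qed
        ultimately show "?p (f \<oplus>\<^bsub>?F\<^esub> (r \<odot>\<^bsub>?F\<^esub> basis_vec R s)) = ?z"
          using p(2)[OF add.hyps(1) M.smult_closed[OF add.hyps(4) b]] p(3)[OF add.hyps(4) b]
          by (simp del: free_module_simps)
      qed
    qed
    then show "?p f = ?z" using vals by blast
  qed
qed

lemma pure_unit_eq_iff:
  assumes f: "f \<in> carrier (free_module R S)" and g: "g \<in> carrier (free_module R S)"
  shows "pure_tensor R (free_module R S) (residue_field R \<mm>) f unit
           = pure_tensor R (free_module R S) (residue_field R \<mm>) g unit \<longleftrightarrow>
         (\<exists>v\<in>carrier (free_module R S). (\<forall>s. v s \<in> \<mm>) \<and> (\<forall>s. f s = g s \<oplus> v s))"
proof -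
  let ?k = "residue_field R \<mm>" and ?F = "free_module R S"
  interpret module_pair R ?F ?k by (intro module_pair.intro module_free module_residue)
  interpret T: module R "tensor_module R ?F ?k" by (rule module_tensor)
  let ?p = "\<lambda>x. pure_tensor R ?F ?k x unit"
  note p = linear_mapD[OF pure_unit_linear[OF module_free]]
  have add: "?p f = ?p g \<oplus>\<^bsub>tensor_module R ?F ?k\<^esub> ?p v"
    if "v \<in> carrier ?F" "\<And>s. f s = g s \<oplus> v s" for v
  proof -
    have "f = g \<oplus>\<^bsub>?F\<^esub> v" using that(2) by auto
    then show ?thesis using p(2)[OF g that(1)] by metis
  qed
  show ?thesis
  proof
    assume eq: "?p f = ?p g"
    let ?v = "f \<ominus>\<^bsub>?F\<^esub> g"
    have v: "?v \<in> carrier ?F" using f g by (rule M.M.minus_closed)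
    have fv: "f s = g s \<oplus> ?v s" for s
      unfolding M.M.minus_eq free_module_a_inv[OF g]
      using free_module_closed[OF f, of s] free_module_closed[OF g, of s]
      by (simp add: a_lcomm[of "g s" "f s"] r_neg)
    have "?p g = ?p g \<oplus>\<^bsub>tensor_module R ?F ?k\<^esub> ?p ?v" using add[OF v fv] eq by simp
    then have "?p ?v = \<zero>\<^bsub>tensor_module R ?F ?k\<^esub>"
      using T.M.add.l_cancel_one'[OF p(1)[OF g] p(1)[OF v]] by simp
    then have "\<forall>s. ?v s \<in> \<mm>" using pure_unit_zero_iff[OF v] by blast
    then show "\<exists>v\<in>carrier ?F. (\<forall>s. v s \<in> \<mm>) \<and> (\<forall>s. f s = g s \<oplus> v s)"
      using v fv by (intro bexI[of _ ?v]) auto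
  next
    assume "\<exists>v\<in>carrier ?F. (\<forall>s. v s \<in> \<mm>) \<and> (\<forall>s. f s = g s \<oplus> v s)"
    then obtain v where v: "v \<in> carrier ?F" "\<forall>s. v s \<in> \<mm>" "\<And>s. f s = g s \<oplus> v s" by blast
    have "?p v = \<zero>\<^bsub>tensor_module R ?F ?k\<^esub>" using pure_unit_zero_iff[OF v(1)] v(2) by blast
    then show "?p f = ?p g" using add[OF v(1,3)] p(1)[OF g] by simp
  qed
qed

end

section \<open>The canonical resolution\<close>

locale cover = module R L for R (structure) and L +
  fixes c :: "'c \<Rightarrow> 's"
  assumes inj: "inj_on c (carrier L)"
begin

lemma cover_linear: "linear_map R (free_cover R L c) L (cover_map R L c)"
  unfolding free_cover_def cover_map_def
  using the_inv_into_into[OF inj] by (intro linear_ext_linear) auto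

lemma cover_surj: "cover_map R L c ` carrier (free_cover R L c) = carrier L"
proof
  show "cover_map R L c ` carrier (free_cover R L c) \<subseteq> carrier L"
    using linear_mapD(1)[OF cover_linear] by auto
  show "carrier L \<subseteq> cover_map R L c ` carrier (free_cover R L c)"
  proof
    fix x assume x: "x \<in> carrier L"
    have "cover_map R L c (basis_vec R (c x)) = x"
      unfolding cover_map_def using linear_ext_basis_vec[of "the_inv_into (carrier L) c" "c x"] x
      by (simp add: the_inv_into_f_f[OF inj])
    moreover have "basis_vec R (c x) \<in> carrier (free_cover R L c)"
      unfolding free_cover_def using x by (intro R.basis_vec_closed) simp
    ultimately show "x \<in> cover_map R L c ` carrier (free_cover R L c)" by force
  qed
qed

lemma kernel_carrier:
  "carrier (cover_kernel R L c) = {f \<in> carrier (free_cover R L c). cover_map R L c f = \<zero>\<^bsub>L\<^esub>}"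
  by (simp add: cover_kernel_def a_kernel_def')

lemma module_kernel: "module R (cover_kernel R L c)"
proof -
  have F: "module R (free_cover R L c)"
    unfolding free_cover_def by (rule R.module_free)
  show ?thesis
    using submodule.submodule_is_module[OF linear_map_kernel[OF F module_axioms cover_linear] F]
    by (simp add: cover_kernel_def a_kernel_def')
qed

end

lemma cover_kernel_simps:
  "\<zero>\<^bsub>cover_kernel R L c\<^esub> = (\<lambda>_. \<zero>\<^bsub>R\<^esub>)"
  "f \<oplus>\<^bsub>cover_kernel R L c\<^esub> g = (\<lambda>s. f s \<oplus>\<^bsub>R\<^esub> g s)"
  "r \<odot>\<^bsub>cover_kernel R L c\<^esub> f = (\<lambda>s. r \<otimes>\<^bsub>R\<^esub> f s)"
  by (simp_all add: cover_kernel_def free_cover_def)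

text \<open>A function is determined by its graph over its support. Finite supports are required
  because \<open>Abs_fset\<close> is only known to be injective on finite sets.\<close>

lemma comb_index_inj: "inj_on (comb_index R) {f. finite {s. f s \<noteq> \<zero>\<^bsub>R\<^esub>}}"
proof (rule inj_onI)
  fix f g :: "('a, 'b) basis_index \<Rightarrow> 'a"
  let ?graph = "\<lambda>f. {(s, f s) |s. f s \<noteq> \<zero>\<^bsub>R\<^esub>}"
  assume fin: "f \<in> {f. finite {s. f s \<noteq> \<zero>\<^bsub>R\<^esub>}}" "g \<in> {f. finite {s. f s \<noteq> \<zero>\<^bsub>R\<^esub>}}"
  have "finite (?graph h)" if "finite {s. h s \<noteq> \<zero>\<^bsub>R\<^esub>}" for h :: "('a, 'b) basis_index \<Rightarrow> 'a"
  proof -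
    have "?graph h = (\<lambda>s. (s, h s)) ` {s. h s \<noteq> \<zero>\<^bsub>R\<^esub>}" by auto
    then show ?thesis using that by simp
  qed
  moreover assume "comb_index R f = comb_index R g"
  ultimately have graph: "?graph f = ?graph g"
    using fin unfolding comb_index_def by (simp add: Abs_fset_inject)
  show "f = g"
  proof
    fix s
    have "a = f s \<and> f s \<noteq> \<zero>\<^bsub>R\<^esub> \<longleftrightarrow> a = g s \<and> g s \<noteq> \<zero>\<^bsub>R\<^esub>" for a
      using arg_cong[OF graph, of "\<lambda>A. (s, a) \<in> A"] by simp
    from this[of "f s"] this[of "g s"] show "f s = g s" by metis
  qed
qed

text \<open>Index sets that present all terms uniformly as \<open>free_module\<close>, the form that
  \<open>free_resolution\<close> expects.\<close>

primrec res_basis ::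
    "('a, 'm) ring_scheme \<Rightarrow> ('a, 'b, 'n) module_scheme \<Rightarrow> nat \<Rightarrow> ('a, 'b) basis_index set" where
  "res_basis R M 0 = Elem ` carrier M"
| "res_basis R M (Suc n) = comb_index R ` carrier (syzygy R M n)"

lemma res_term_eq: "res_term R M n = free_module R (res_basis R M n)"
  by (cases n) (simp_all add: free_cover_def)

context module
begin

lemma cover_Elem: "cover R M Elem"
  by (intro cover.intro cover_axioms.intro module_axioms) (simp add: inj_on_def)

text \<open>Injectivity of \<open>comb_index\<close> on a syzygy needs finite supports, so the
  induction carries the inclusion into the free term along with the module structure.\<close>

lemma cover_syzygy: "cover R (syzygy R M n) (comb_index R)"
proof -
  have "module R (syzygy R M n) \<and> carrier (syzygy R M n) \<subseteq> carrier (res_term R M n)"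
  proof (induction n)
    case 0
    show ?case
      using cover.module_kernel[OF cover_Elem] cover.kernel_carrier[OF cover_Elem] by auto
  next
    case (Suc n)
    have "carrier (syzygy R M n) \<subseteq> {f. finite {s. f s \<noteq> \<zero>\<^bsub>R\<^esub>}}"
      using Suc unfolding res_term_eq by (auto simp: free_module_simps(1))
    then have "cover R (syzygy R M n) (comb_index R)"
      using Suc inj_on_subset[OF comb_index_inj]
      by (intro cover.intro cover_axioms.intro) auto
    from cover.module_kernel[OF this] cover.kernel_carrier[OF this] show ?case by auto
  qed
  moreover from this have "carrier (syzygy R M n) \<subseteq> {f. finite {s. f s \<noteq> \<zero>\<^bsub>R\<^esub>}}"
    unfolding res_term_eq by (auto simp: free_module_simps(1))
  ultimately show ?thesis
    using inj_on_subset[OF comb_index_inj] by (intro cover.intro cover_axioms.intro) auto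
qed

lemma syzygy_simps:
  "\<zero>\<^bsub>syzygy R M n\<^esub> = (\<lambda>_. \<zero>\<^bsub>R\<^esub>)"
  "f \<oplus>\<^bsub>syzygy R M n\<^esub> g = (\<lambda>s. f s \<oplus>\<^bsub>R\<^esub> g s)"
  "r \<odot>\<^bsub>syzygy R M n\<^esub> f = (\<lambda>s. r \<otimes>\<^bsub>R\<^esub> f s)"
  by (cases n; simp add: cover_kernel_simps)+

lemma syzygy_0_carrier:
  "carrier (syzygy R M 0) = {f \<in> carrier (res_term R M 0). cover_map R M Elem f = \<zero>\<^bsub>M\<^esub>}"
  using cover.kernel_carrier[OF cover_Elem] by simp

lemma syzygy_Suc_carrier:
  "carrier (syzygy R M (Suc n)) = {f \<in> carrier (res_term R M (Suc n)). res_diff R M n f = (\<lambda>_. \<zero>\<^bsub>R\<^esub>)}"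
  using cover.kernel_carrier[OF cover_syzygy] by (simp add: syzygy_simps res_diff_def)

lemma res_diff_image: "res_diff R M n ` carrier (res_term R M (Suc n)) = carrier (syzygy R M n)"
  using cover.cover_surj[OF cover_syzygy] by (simp add: res_diff_def)

lemma res_diff_linear: "linear_map R (res_term R M (Suc n)) (res_term R M n) (res_diff R M n)"
proof -
  have lin: "linear_map R (res_term R M (Suc n)) (syzygy R M n) (res_diff R M n)"
    using cover.cover_linear[OF cover_syzygy] by (simp add: res_diff_def)
  have "carrier (syzygy R M n) \<subseteq> carrier (res_term R M n)"
    using syzygy_0_carrier syzygy_Suc_carrier by (cases n) auto
  then show ?thesis
    using linear_mapD[OF lin] unfolding res_term_eq syzygy_simps
    by (intro linear_mapI) auto
qed

end

section \<open>Vanishing of Tor and reflexive modules\<close>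

context noetherian_local_cring
begin

text \<open>Every tensor with \<open>k\<close> has the form \<open>x \<otimes> unit\<close> and
  vanishes exactly if \<open>x\<close> has coefficients in \<open>\<mm>\<close>, so cycles and
  boundaries can be described by chains of the resolution. The right-hand side is the condition
  expressed by \<open>Z\<close> and \<open>fills\<close>.\<close>

lemma Tor_Suc_zero_iff:
  assumes M: "module R M"
  shows "is_zero_module (Tor R (Suc n) M (residue_field R \<mm>)) \<longleftrightarrow>
    (\<forall>g\<in>carrier (res_term R M (Suc n)). (\<forall>s. res_diff R M n g s \<in> \<mm>) \<longrightarrow>
      (\<exists>e\<in>carrier (res_term R M (Suc (Suc n))). \<exists>v\<in>carrier (res_term R M (Suc n)).
         (\<forall>s. v s \<in> \<mm>) \<and> (\<forall>s. g s = res_diff R M (Suc n) e s \<oplus> v s)))"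
proof -
  interpret M: module R M by fact
  let ?k = "residue_field R \<mm>"
  let ?F = "res_term R M" and ?d = "res_diff R M"
  let ?T = "\<lambda>n. tensor_module R (?F n) ?k" and ?p = "\<lambda>n x. pure_tensor R (?F n) ?k x unit"
  have F: "module R (?F n)" for n unfolding res_term_eq by (rule module_free)
  have T: "module R (?T n)" for n
    by (intro module_pair.module_tensor module_pair.intro F module_residue)
  interpret T: module R "?T (Suc n)" by (rule T)
  note p = pure_unit_linear[OF F]
  have carrier_T: "carrier (?T n) = ?p n ` carrier (?F n)" for n
    using tensor_residue_pure[OF F, of _ n] linear_mapD(1)[OF p[of n]] by blast
  have d_closed: "?d n g \<in> carrier (?F n)" if "g \<in> carrier (?F (Suc n))" for n g
    using linear_mapD(1)[OF M.res_diff_linear that] .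
  have diff: "tor_diff R M ?k n (?p (Suc n) g) = ?p n (?d n g)" if "g \<in> carrier (?F (Suc n))" for n g
    unfolding tor_diff_def
    by (rule tensor_map_pure[OF F F module_residue M.res_diff_linear that unit_closed])
  have B: "tor_boundaries R M ?k (Suc n)
      = (\<lambda>e. ?p (Suc n) (?d (Suc n) e)) ` carrier (?F (Suc (Suc n)))"
    unfolding tor_boundaries_def tor_term_def carrier_T image_image
    by (intro image_cong refl diff)
  have "linear_map R (?F (Suc (Suc n))) (?T (Suc n)) (\<lambda>e. ?p (Suc n) (?d (Suc n) e))"
    using linear_mapD[OF p[of "Suc n"]] linear_mapD[OF M.res_diff_linear[of "Suc n"]]
    by (intro linear_mapI) auto
  then have subB: "submodule (tor_boundaries R M ?k (Suc n)) R (?T (Suc n))"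
    unfolding B by (rule linear_map_image[OF F T])
  have C: "tor_cycles R M ?k (Suc n)
      = ?p (Suc n) ` {g \<in> carrier (?F (Suc n)). ?p n (?d n g) = \<zero>\<^bsub>?T n\<^esub>}"
  proof -
    have "tor_cycles R M ?k (Suc n)
        = {X \<in> ?p (Suc n) ` carrier (?F (Suc n)). tor_diff R M ?k n X = \<zero>\<^bsub>?T n\<^esub>}"
      unfolding tor_cycles_def tor_term_def by (simp add: a_kernel_def' carrier_T del: res_term.simps)
    also have "\<dots> = ?p (Suc n) ` {g \<in> carrier (?F (Suc n)). tor_diff R M ?k n (?p (Suc n) g) = \<zero>\<^bsub>?T n\<^esub>}"
      by blast
    also have "\<dots> = ?p (Suc n) ` {g \<in> carrier (?F (Suc n)). ?p n (?d n g) = \<zero>\<^bsub>?T n\<^esub>}"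
      using diff by (intro arg_cong[of _ _ "image (?p (Suc n))"] Collect_cong) (metis (no_types))
    finally show ?thesis .
  qed
  \<comment> \<open>The zero chain shows that there are cycles at all, as
    \<open>zero_quotient_iff\<close> asks.\<close>
  have zero: "(\<lambda>_. \<zero>) \<in> carrier (?F (Suc n))"
    unfolding res_term_eq by (simp add: free_module_simps(1))
  have "?d n (\<lambda>_. \<zero>) = (\<lambda>_. \<zero>)"
    using linear_map_zero[OF F F M.res_diff_linear[of n]] unfolding res_term_eq by simp
  then have "?p n (?d n (\<lambda>_. \<zero>)) = \<zero>\<^bsub>?T n\<^esub>"
    using linear_map_zero[OF F T p, of n] unfolding res_term_eq by simp
  then have "tor_cycles R M ?k (Suc n) \<noteq> {}" unfolding C using zero by blast
  moreover have "tor_cycles R M ?k (Suc n) \<subseteq> carrier (?T (Suc n))"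
    unfolding C carrier_T by blast
  ultimately have "is_zero_module (Tor R (Suc n) M ?k) \<longleftrightarrow>
      tor_cycles R M ?k (Suc n) \<subseteq> tor_boundaries R M ?k (Suc n)"
    unfolding Tor_def tor_term_def by (intro T.zero_quotient_iff[OF subB])
  also have "\<dots> \<longleftrightarrow> (\<forall>g\<in>carrier (?F (Suc n)). ?p n (?d n g) = \<zero>\<^bsub>?T n\<^esub> \<longrightarrow>
      (\<exists>e\<in>carrier (?F (Suc (Suc n))). ?p (Suc n) g = ?p (Suc n) (?d (Suc n) e)))"
    unfolding B C image_subset_iff image_iff by blast
  also have "\<dots> \<longleftrightarrow> (\<forall>g\<in>carrier (?F (Suc n)). (\<forall>s. ?d n g s \<in> \<mm>) \<longrightarrow>
      (\<exists>e\<in>carrier (?F (Suc (Suc n))). \<exists>v\<in>carrier (?F (Suc n)).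
        (\<forall>s. v s \<in> \<mm>) \<and> (\<forall>s. g s = ?d (Suc n) e s \<oplus> v s)))"
  proof (intro ball_cong refl imp_cong bex_cong)
    show "?p n (?d n g) = \<zero>\<^bsub>?T n\<^esub> \<longleftrightarrow> (\<forall>s. ?d n g s \<in> \<mm>)" if "g \<in> carrier (?F (Suc n))" for g
      using d_closed[OF that] unfolding res_term_eq by (rule pure_unit_zero_iff)
    show "?p (Suc n) g = ?p (Suc n) (?d (Suc n) e) \<longleftrightarrow>
        (\<exists>v\<in>carrier (?F (Suc n)). (\<forall>s. v s \<in> \<mm>) \<and> (\<forall>s. g s = ?d (Suc n) e s \<oplus> v s))"
      if "g \<in> carrier (?F (Suc n))" "e \<in> carrier (?F (Suc (Suc n)))" for g e
      using that(1) d_closed[OF that(2)] unfolding res_term_eq by (rule pure_unit_eq_iff)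
  qed
  finally show ?thesis .
qed

end

section \<open>Duals, and reflexivity in terms of functionals\<close>

lemma dual_module_simps:
  "\<phi> \<in> carrier (dual_module R M) \<longleftrightarrow> \<phi> \<in> extensional (carrier M) \<and> linear_map R M (self_module R) \<phi>"
  "\<phi> \<oplus>\<^bsub>dual_module R M\<^esub> \<psi> = (\<lambda>x\<in>carrier M. \<phi> x \<oplus>\<^bsub>R\<^esub> \<psi> x)"
  "r \<odot>\<^bsub>dual_module R M\<^esub> \<phi> = (\<lambda>x\<in>carrier M. r \<otimes>\<^bsub>R\<^esub> \<phi> x)"
  unfolding dual_module_def Hom_module_def linear_map_def PiE_def by auto

text \<open>Injectivity of the bidual map, in other words the embedding of \<open>M\<close> into the
  product \<open>P\<^sub>0\<close>.\<close>

lemma reflexive_module_eqI: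
  assumes "reflexive_module R M" "x \<in> carrier M" "y \<in> carrier M"
    and "\<And>\<phi>. \<phi> \<in> carrier (dual_module R M) \<Longrightarrow> \<phi> x = \<phi> y"
  shows "x = y"
proof -
  have "bidual_map R M x = bidual_map R M y"
    unfolding bidual_map_def using assms(2-) by (simp add: restrict_def fun_eq_iff)
  then show ?thesis
    using assms(1-3) unfolding reflexive_module_def by (meson bij_betw_imp_inj_on inj_onD)
qed

text \<open>Surjectivity of the bidual map; it stands for exactness at
  \<open>P\<^sub>0\<close>.\<close>

lemma reflexive_module_evaluation:
  assumes "reflexive_module R M" "\<psi> \<in> carrier (dual_module R (dual_module R M))"
  obtains x where "x \<in> carrier M" "\<And>\<phi>. \<phi> \<in> carrier (dual_module R M) \<Longrightarrow> \<phi> x = \<psi> \<phi>"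
proof -
  have "bidual_map R M ` carrier M = carrier (dual_module R (dual_module R M))"
    using assms(1) unfolding reflexive_module_def bij_betw_def by simp
  then obtain x where x: "x \<in> carrier M" "bidual_map R M x = \<psi>"
    using assms(2) by (metis imageE)
  have "\<phi> x = \<psi> \<phi>" if "\<phi> \<in> carrier (dual_module R M)" for \<phi>
    using that x unfolding bidual_map_def by (auto simp: restrict_def)
  then show thesis using that x(1) by blast
qed

context cring
begin

text \<open>
  Dividing \<open>\<phi> x\<close> by \<open>y\<^sup>t\<close> makes sense because \<open>y\<^sup>c r\<close> is determined by \<open>y\<^bsup>c + t\<^esup> r\<close>; the result is
  linear in \<open>\<phi>\<close> and hence given by an element of \<open>M\<close>.
\<close>

lemma reflexive_divide_power:
  assumes M: "reflexive_module R M" and x: "x \<in> carrier M" and y: "y \<in> carrier R"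
    and c: "\<forall>(k::nat). \<forall>r\<in>carrier R. y [^] k \<otimes> r = \<zero> \<longrightarrow> y [^] c \<otimes> r = \<zero>"
    and div: "\<forall>\<phi>\<in>carrier (dual_module R M). \<phi> x \<in> PIdl (y [^] (c + t))"
  shows "\<exists>z\<in>carrier M. x = y [^] (t::nat) \<odot>\<^bsub>M\<^esub> z"
proof -
  let ?D = "dual_module R M"
  let ?b = "y [^] (c + t)"
  interpret M: module R M using M unfolding reflexive_module_def by blast
  have bc: "?b \<in> carrier R" and yc: "y [^] c \<in> carrier R" and yt: "y [^] t \<in> carrier R" using y by auto
  have b: "?b = y [^] t \<otimes> y [^] c" using y by (simp add: nat_pow_mult add.commute)
  have "\<forall>\<phi>\<in>carrier ?D. \<exists>r\<in>carrier R. \<phi> x = ?b \<otimes> r"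
    using div bc unfolding cgenideal_def by (fastforce simp: m_comm)
  then obtain r where r: "\<And>\<phi>. \<phi> \<in> carrier ?D \<Longrightarrow> r \<phi> \<in> carrier R"
    "\<And>\<phi>. \<phi> \<in> carrier ?D \<Longrightarrow> \<phi> x = ?b \<otimes> r \<phi>" by metis
  have cancel: "y [^] c \<otimes> p = y [^] c \<otimes> q"
    if "p \<in> carrier R" "q \<in> carrier R" "?b \<otimes> p = ?b \<otimes> q" for p q
  proof -
    have "?b \<otimes> (p \<oplus> \<ominus> q) = \<zero>" using that bc by (simp add: r_distr r_minus r_neg)
    then have "y [^] c \<otimes> (p \<oplus> \<ominus> q) = \<zero>" using c that by simp
    then have "y [^] c \<otimes> p \<oplus> \<ominus> (y [^] c \<otimes> q) = \<zero>" using that yc by (simp add: r_distr r_minus)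
    then have "y [^] c \<otimes> p = \<ominus> (\<ominus> (y [^] c \<otimes> q))" using that yc by (intro sum_zero_eq_neg) auto
    then show ?thesis using that yc by simp
  qed
  have D_add: "\<phi> \<oplus>\<^bsub>?D\<^esub> \<psi> \<in> carrier ?D" if "\<phi> \<in> carrier ?D" "\<psi> \<in> carrier ?D" for \<phi> \<psi>
    using that unfolding dual_module_simps
    by (auto intro!: linear_mapI simp: functionalD r_distr a_ac M.M.a_closed)
  have D_smult: "a \<odot>\<^bsub>?D\<^esub> \<phi> \<in> carrier ?D" if "a \<in> carrier R" "\<phi> \<in> carrier ?D" for a \<phi>
    using that unfolding dual_module_simps
    by (auto intro!: linear_mapI simp: functionalD r_distr m_lcomm M.M.a_closed)
  \<comment> \<open>The choices of \<open>r\<close> at different functionals are unrelated.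
    Linearity holds because both sides become quotients of the same multiple of \<open>?b\<close>,
    which \<open>cancel\<close> identifies after multiplication by \<open>y [^] c\<close>.\<close>
  let ?\<psi> = "\<lambda>\<phi>\<in>carrier ?D. y [^] c \<otimes> r \<phi>"
  have "linear_map R ?D (self_module R) ?\<psi>"
  proof (rule linear_mapI)
    show "?\<psi> \<phi> \<in> carrier (self_module R)" if "\<phi> \<in> carrier ?D" for \<phi>
      using that r yc by simp
    show "?\<psi> (\<phi> \<oplus>\<^bsub>?D\<^esub> \<psi>) = ?\<psi> \<phi> \<oplus>\<^bsub>self_module R\<^esub> ?\<psi> \<psi>" if "\<phi> \<in> carrier ?D" "\<psi> \<in> carrier ?D" for \<phi> \<psi>
    proof -
      have "(\<phi> \<oplus>\<^bsub>?D\<^esub> \<psi>) x = \<phi> x \<oplus> \<psi> x" using x by (simp add: dual_module_simps)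
      then have "?b \<otimes> r (\<phi> \<oplus>\<^bsub>?D\<^esub> \<psi>) = ?b \<otimes> (r \<phi> \<oplus> r \<psi>)"
        using r that D_add[OF that] bc by (simp add: r_distr)
      then have "y [^] c \<otimes> r (\<phi> \<oplus>\<^bsub>?D\<^esub> \<psi>) = y [^] c \<otimes> (r \<phi> \<oplus> r \<psi>)"
        using r that D_add[OF that] by (intro cancel) auto
      then show ?thesis using r that D_add[OF that] yc by (simp add: r_distr)
    qed
    show "?\<psi> (a \<odot>\<^bsub>?D\<^esub> \<phi>) = a \<odot>\<^bsub>self_module R\<^esub> ?\<psi> \<phi>" if "a \<in> carrier R" "\<phi> \<in> carrier ?D" for a \<phi>
    proof -
      have "(a \<odot>\<^bsub>?D\<^esub> \<phi>) x = a \<otimes> \<phi> x" using x by (simp add: dual_module_simps)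
      then have "?b \<otimes> r (a \<odot>\<^bsub>?D\<^esub> \<phi>) = ?b \<otimes> (a \<otimes> r \<phi>)"
        using r that D_smult[OF that] bc by (simp add: m_lcomm)
      then have "y [^] c \<otimes> r (a \<odot>\<^bsub>?D\<^esub> \<phi>) = y [^] c \<otimes> (a \<otimes> r \<phi>)"
        using r that D_smult[OF that] by (intro cancel) auto
      then show ?thesis using r that D_smult[OF that] yc by (simp add: m_lcomm)
    qed
  qed
  then have "?\<psi> \<in> carrier (dual_module R ?D)"
    unfolding dual_module_simps(1)[of _ R ?D] by simp
  then obtain z where z: "z \<in> carrier M" "\<And>\<phi>. \<phi> \<in> carrier ?D \<Longrightarrow> \<phi> z = ?\<psi> \<phi>"
    using reflexive_module_evaluation[OF M] by blast
  have "x = y [^] t \<odot>\<^bsub>M\<^esub> z"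
  proof (rule reflexive_module_eqI[OF M x])
    show "y [^] t \<odot>\<^bsub>M\<^esub> z \<in> carrier M" using yt z by simp
    fix \<phi> assume \<phi>: "\<phi> \<in> carrier ?D"
    then have "\<phi> (y [^] t \<odot>\<^bsub>M\<^esub> z) = y [^] t \<otimes> \<phi> z"
      using linear_mapD(3)[of R M "self_module R" \<phi>] yt z(1) unfolding dual_module_simps by simp
    also have "\<dots> = y [^] t \<otimes> (y [^] c \<otimes> r \<phi>)" using z(2)[OF \<phi>] \<phi> by simp
    also have "\<dots> = \<phi> x" using r[OF \<phi>] yt yc unfolding b by (simp add: m_assoc)
    finally show "\<phi> x = \<phi> (y [^] t \<odot>\<^bsub>M\<^esub> z)" by simp
  qed
  then show ?thesis using z(1) by blast
qed

end

text \<open>In degree \<open>0\<close> these are the coordinates of the composite of the cover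
  \<open>F\<^sub>0 \<rightarrow> M\<close> with the embedding into a product of copies of
  \<open>R\<close>, one for each functional on \<open>M\<close>.\<close>

definition res_functionals ::
    "('a, 'm) ring_scheme \<Rightarrow> ('a, 'b, 'n) module_scheme \<Rightarrow> nat
      \<Rightarrow> ((('a, 'b) basis_index \<Rightarrow> 'a) \<Rightarrow> 'a) set" where
  "res_functionals R M n =
     (case n of
        0 \<Rightarrow> (\<lambda>\<phi> g. \<phi> (cover_map R M Elem g)) ` carrier (dual_module R M)
      | Suc k \<Rightarrow> range (\<lambda>s g. res_diff R M k g s))"

text \<open>Reflexivity enters in degree \<open>0\<close> only: functionals separate the points of
  \<open>M\<close>, which gives exactness there, and \<open>reflexive_divide_power\<close> gives
  \<open>power_multiple\<close>.\<close>

lemma (in noetherian_local_cring) free_resolution_reflexive: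
  assumes M: "reflexive_module R M"
  shows "free_resolution R \<mm> (res_basis R M) (res_diff R M) (res_functionals R M)"
proof (intro free_resolution.intro free_resolution_axioms.intro noetherian_local_cring_axioms)
  interpret M: module R M using M unfolding reflexive_module_def by blast
  let ?\<epsilon> = "cover_map R M Elem"
  have \<epsilon>: "linear_map R (free_module R (res_basis R M 0)) M ?\<epsilon>"
    using cover.cover_linear[OF M.cover_Elem] by (simp add: free_cover_def)
  have \<epsilon>_surj: "?\<epsilon> ` carrier (free_module R (res_basis R M 0)) = carrier M"
    using cover.cover_surj[OF M.cover_Elem] by (simp add: free_cover_def)
  show diff: "linear_map R (free_module R (res_basis R M (Suc n))) (free_module R (res_basis R M n))
      (res_diff R M n)" for n
    using M.res_diff_linear unfolding res_term_eq .
  show "linear_map R (free_module R (res_basis R M n)) (self_module R) l"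
    if "l \<in> res_functionals R M n" for l n
  proof (cases n)
    case 0
    have "l \<in> (\<lambda>\<phi> g. \<phi> (?\<epsilon> g)) ` carrier (dual_module R M)"
      using that unfolding 0 res_functionals_def by simp
    then obtain \<phi> where "l = (\<lambda>g. \<phi> (?\<epsilon> g))" "\<phi> \<in> carrier (dual_module R M)" by (rule imageE)
    moreover from this(2) have "linear_map R M (self_module R) \<phi>" by (simp add: dual_module_simps)
    ultimately show ?thesis
      using linear_mapD[OF \<epsilon>] unfolding 0 by (intro linear_mapI) (auto simp: functionalD)
  next
    case (Suc k)
    have "l \<in> range (\<lambda>s g. res_diff R M k g s)"
      using that unfolding Suc res_functionals_def by simp
    then obtain s where "l = (\<lambda>g. res_diff R M k g s)" by (rule rangeE)
    then show ?thesis
      using linear_mapD[OF diff[of k]] free_module_closed[OF linear_mapD(1)[OF diff[of k]]]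
      unfolding Suc by (intro linear_mapI) (auto simp del: res_basis.simps)
  qed
  show "res_functionals R M (Suc n) = range (\<lambda>s g. res_diff R M n g s)" for n
    by (simp add: res_functionals_def)
  show exact: "(\<forall>l\<in>res_functionals R M n. l g = \<zero>) \<longleftrightarrow>
      g \<in> res_diff R M n ` carrier (free_module R (res_basis R M (Suc n)))"
    if g: "g \<in> carrier (free_module R (res_basis R M n))" for g n
  proof -
    have "g \<in> res_diff R M n ` carrier (free_module R (res_basis R M (Suc n)))
        \<longleftrightarrow> g \<in> carrier (syzygy R M n)"
      using M.res_diff_image unfolding res_term_eq by simp
    also have "\<dots> \<longleftrightarrow> (\<forall>l\<in>res_functionals R M n. l g = \<zero>)"
    proof (cases n)
      case 0
      have \<epsilon>g: "?\<epsilon> g \<in> carrier M" using linear_mapD(1)[OF \<epsilon>] g unfolding 0 by blast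
      have "?\<epsilon> g = \<zero>\<^bsub>M\<^esub> \<longleftrightarrow> (\<forall>\<phi>\<in>carrier (dual_module R M). \<phi> (?\<epsilon> g) = \<zero>)"
      proof -
        have zero: "\<phi> \<zero>\<^bsub>M\<^esub> = \<zero>" if "\<phi> \<in> carrier (dual_module R M)" for \<phi>
          using linear_map_zero[OF M.module_axioms module_self] that by (simp add: dual_module_simps)
        show ?thesis using reflexive_module_eqI[OF M \<epsilon>g M.M.zero_closed] zero by auto
      qed
      then show ?thesis
        using g M.syzygy_0_carrier unfolding 0 res_functionals_def res_term_eq by simp
    next
      case (Suc k)
      show ?thesis
        using g M.syzygy_Suc_carrier[of k] unfolding Suc res_functionals_def res_term_eq
        by (auto simp del: syzygy.simps res_basis.simps)
    qed
    finally show ?thesis by blast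
  qed
  fix y c g and t :: nat
  let ?F0 = "free_module R (res_basis R M 0)"
  assume y: "y \<in> carrier R"
    and c: "\<And>(k::nat) r. r \<in> carrier R \<Longrightarrow> y [^] k \<otimes> r = \<zero> \<Longrightarrow> y [^] c \<otimes> r = \<zero>"
    and g: "g \<in> carrier ?F0"
    and div: "\<And>l. l \<in> res_functionals R M 0 \<Longrightarrow> l g \<in> PIdl (y [^] (c + t))"
  have \<epsilon>g: "?\<epsilon> g \<in> carrier M" using linear_mapD(1)[OF \<epsilon> g] .
  have "\<forall>\<phi>\<in>carrier (dual_module R M). \<phi> (?\<epsilon> g) \<in> PIdl (y [^] (c + t))"
    using div unfolding res_functionals_def by auto
  moreover have "\<forall>(k::nat). \<forall>r\<in>carrier R. y [^] k \<otimes> r = \<zero> \<longrightarrow> y [^] c \<otimes> r = \<zero>"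
    by (intro allI ballI impI) (rule c)
  ultimately have "\<exists>z\<in>carrier M. ?\<epsilon> g = y [^] t \<odot>\<^bsub>M\<^esub> z"
    by (intro reflexive_divide_power[where c = c, OF M \<epsilon>g y])
  then obtain z where z: "z \<in> carrier M" "?\<epsilon> g = y [^] t \<odot>\<^bsub>M\<^esub> z" by (rule bexE)
  have "z \<in> ?\<epsilon> ` carrier ?F0" using z(1) \<epsilon>_surj by simp
  then obtain h where h: "h \<in> carrier ?F0" "?\<epsilon> h = z" by (metis imageE)
  interpret F: module R ?F0 by (rule module_free)
  have yt: "y [^] t \<in> carrier R" using y by simp
  \<comment> \<open>With \<open>h\<close> a lift of the quotient \<open>z\<close>, the difference of
    \<open>g\<close> and \<open>y [^] t\<close> times \<open>h\<close> is killed by the cover and is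
    therefore a boundary.\<close>
  let ?g = "g \<oplus>\<^bsub>?F0\<^esub> (\<ominus> (y [^] t)) \<odot>\<^bsub>?F0\<^esub> h"
  have yh: "(\<ominus> (y [^] t)) \<odot>\<^bsub>?F0\<^esub> h \<in> carrier ?F0" using yt h by (intro F.smult_closed) auto
  have g': "?g \<in> carrier ?F0" using g yh by (rule F.M.a_closed)
  have "?\<epsilon> ?g = ?\<epsilon> g \<oplus>\<^bsub>M\<^esub> (\<ominus> (y [^] t)) \<odot>\<^bsub>M\<^esub> z"
    using linear_mapD(2)[OF \<epsilon> g yh] linear_mapD(3)[OF \<epsilon> _ h(1), of "\<ominus> (y [^] t)"] yt h(2) by simp
  also have "\<dots> = \<zero>\<^bsub>M\<^esub>" using z yt by (simp add: M.smult_l_minus M.M.r_neg)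
  finally have "?g \<in> carrier (syzygy R M 0)"
    using g' unfolding M.syzygy_0_carrier res_term_eq by blast
  then obtain e where e: "e \<in> carrier (free_module R (res_basis R M (Suc 0)))" "?g = res_diff R M 0 e"
    using M.res_diff_image[of 0] unfolding res_term_eq by blast
  have "g s = res_diff R M 0 e s \<oplus> y [^] t \<otimes> h s" for s
    unfolding e(2)[symmetric]
    using yt free_module_closed[OF g] free_module_closed[OF h(1)] by (simp add: l_minus a_assoc l_neg)
  then show "\<exists>e\<in>carrier (free_module R (res_basis R M (Suc 0))). \<exists>h\<in>carrier ?F0.
      \<forall>s. g s = res_diff R M 0 e s \<oplus> y [^] t \<otimes> h s"
    using e(1) h(1) by blast
qed

theorem proposition3p9:
  fixes R :: "('a, 'm) ring_scheme" and \<mm> :: "'a set"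
    and M :: "('a, 'b, 'n) module_scheme" and i :: nat
  assumes "local_ring R \<mm>"
    and "noetherian_ring R"
    and "krull_dim R = 3"
    and "module R M"
    and "reflexive_module R M"
    and "i > 0"
    and "is_zero_module (Tor R i M (residue_field R \<mm>))"
  shows "\<forall>j>i. is_zero_module (Tor R j M (residue_field R \<mm>))"
proof -
  interpret noetherian_local_cring R \<mm>
    using assms(1,2) unfolding local_ring_def
    by (intro noetherian_local_cring.intro noetherian_cring.intro noetherian_local_cring_axioms.intro)
      (simp_all add: local_ring_def)
  interpret free_resolution R \<mm> "res_basis R M" "res_diff R M" "res_functionals R M"
    by (rule free_resolution_reflexive[OF assms(5)])
  have Tor_zero: "is_zero_module (Tor R (Suc n) M (residue_field R \<mm>)) \<longleftrightarrow>
      (\<forall>g\<in>Z (Suc n) \<mm>. fills (Suc n) \<mm> g)" for n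
    unfolding Tor_Suc_zero_iff[OF assms(4)] fills_def Z_Suc res_term_eq by blast
  have dim: "krull_dim R = enat 3" using assms(3) by (simp add: numeral_eq_enat)
  obtain n where n: "i = Suc n" using assms(6) by (cases i) auto
  \<comment> \<open>Here \<open>rigidity\<close> requires \<open>3 \<le> Suc (Suc (Suc k))\<close>.
    This holds from the first positive degree on, which is how \<open>i > 0\<close> and dimension
    \<open>3\<close> fit together.\<close>
  have step: "is_zero_module (Tor R (Suc (Suc k)) M (residue_field R \<mm>))"
    if "is_zero_module (Tor R (Suc k) M (residue_field R \<mm>))" for k
    using that rigidity[OF dim, of "Suc k"] unfolding Tor_zero by auto
  have vanish: "is_zero_module (Tor R (Suc (n + k)) M (residue_field R \<mm>))" for k
  proof (induction k)
    case 0
    then show ?case using assms(7) unfolding n by simp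
  next
    case (Suc k)
    then show ?case using step[of "n + k"] by simp
  qed
  show ?thesis
  proof (intro allI impI)
    fix j assume "i < j"
    then obtain k where "j = Suc (n + Suc k)" unfolding n less_iff_Suc_add by auto
    then show "is_zero_module (Tor R j M (residue_field R \<mm>))" using vanish by blast
  qed
qed

end
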